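(* Let $n\ge4$. Up to isomorphism there is exactly one solvable indecomposable real left Leibniz algebra of dimension $n+2$ whose nilradical is the $n$-dimensional algebra $\mathcal{L}^2$ (codimension two nilradical). It is the algebra $l_{n+2,1}$ with basis $e_1,\dots,e_{n+2}$, where $e_1,\dots,e_n$ span $\mathcal{L}^2$ with its defining brackets and the other brackets are $[e_1,e_{n+1}]=e_1-2e_3$, $[e_3,e_{n+1}]=-e_3$, $[e_4,e_{n+1}]=e_2$, $[e_i,e_{n+1}]=(i-4)e_i$ $(5\le i\le n)$, $[e_{n+1},e_1]=-e_1+2e_3$, $[e_{n+1},e_j]=(4-j)e_j$ $(3\le j\le n)$, $[e_1,e_{n+2}]=e_1$, $[e_3,e_{n+2}]=e_3$, $[e_4,e_{n+2}]=-e_2+2e_4$, $[e_i,e_{n+2}]=(i-2)e_i$ $(5\le i\le n)$, $[e_{n+2},e_1]=-e_1$, $[e_{n+2},e_2]=-2e_2$, $[e_{n+2},e_j]=(2-j)e_j$ $(3\le j\le n)$, all remaining brackets being zero. Moreover $DS=[n+2,n,n-2,0]$ and $LS=[n+2,n,n,\dots]$.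
   Context: All algebras are finite dimensional over $\mathbb{R}$; brackets not listed are zero. A left Leibniz algebra is a vector space with a bilinear bracket satisfying $[[x,y],z]=[x,[y,z]]-[y,[x,z]]$. For a Leibniz algebra $L$: $L^0=L$, $L^{k+1}=[L^k,L]$ (lower central series) and $L^{(0)}=L$, $L^{(k+1)}=[L^{(k)},L^{(k)}]$ (derived series); $L$ is nilpotent (resp. solvable) if some $L^m=0$ (resp. $L^{(m)}=0$). $LS$ and $DS$ denote the lists of dimensions of the terms of the lower central and derived series. The nilradical of a solvable Leibniz algebra is its unique maximal nilpotent ideal. An algebra is indecomposable if it is not a direct sum of two nonzero ideals. For $n\ge4$, $\mathcal{L}^2$ is the $n$-dimensional nilpotent Leibniz algebra with basis $e_1,\dots,e_n$ and only nonzero brackets $[e_1,e_1]=e_2$, $[e_i,e_1]=e_{i+1}$ $(3\le i\le n-1)$, $[e_1,e_3]=e_2-e_4$, $[e_1,e_j]=-e_{j+1}$ $(4\le j\le n-1)$. (It is both a left and a right Leibniz algebra.) *)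

theory Defs
  imports "HOL-Analysis.Finite_Function_Topology"
begin

(* An algebra is given by a carrier V, a linear subspace of an ambient real vector space, and a
   bracket that is only constrained on V.  Ideals are then algebras with the same bracket. *)

definition left_leibniz :: "'a::real_vector set \<Rightarrow> ('a \<Rightarrow> 'a \<Rightarrow> 'a) \<Rightarrow> bool" where
  "left_leibniz V br \<longleftrightarrow>
     subspace V \<and>
     (\<forall>x\<in>V. \<forall>y\<in>V. br x y \<in> V) \<and>
     (\<forall>x\<in>V. \<forall>y\<in>V. \<forall>z\<in>V. br (x + y) z = br x z + br y z) \<and>
     (\<forall>x\<in>V. \<forall>y\<in>V. \<forall>z\<in>V. br x (y + z) = br x y + br x z) \<and>
     (\<forall>c. \<forall>x\<in>V. \<forall>y\<in>V. br (c *\<^sub>R x) y = c *\<^sub>R br x y) \<and>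
     (\<forall>c. \<forall>x\<in>V. \<forall>y\<in>V. br x (c *\<^sub>R y) = c *\<^sub>R br x y) \<and>
     (\<forall>x\<in>V. \<forall>y\<in>V. \<forall>z\<in>V. br (br x y) z = br x (br y z) - br y (br x z))"

definition bracket_span :: "('a::real_vector \<Rightarrow> 'a \<Rightarrow> 'a) \<Rightarrow> 'a set \<Rightarrow> 'a set \<Rightarrow> 'a set" where
  "bracket_span br A B = span {br x y | x y. x \<in> A \<and> y \<in> B}"

primrec lower_central :: "'a::real_vector set \<Rightarrow> ('a \<Rightarrow> 'a \<Rightarrow> 'a) \<Rightarrow> nat \<Rightarrow> 'a set" where
  "lower_central V br 0 = V"
| "lower_central V br (Suc k) = bracket_span br (lower_central V br k) V"

primrec derived_series :: "'a::real_vector set \<Rightarrow> ('a \<Rightarrow> 'a \<Rightarrow> 'a) \<Rightarrow> nat \<Rightarrow> 'a set" where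
  "derived_series V br 0 = V"
| "derived_series V br (Suc k) = bracket_span br (derived_series V br k) (derived_series V br k)"

definition nilpotent_alg :: "'a::real_vector set \<Rightarrow> ('a \<Rightarrow> 'a \<Rightarrow> 'a) \<Rightarrow> bool" where
  "nilpotent_alg V br \<longleftrightarrow> (\<exists>m. lower_central V br m = {0})"

definition solvable_alg :: "'a::real_vector set \<Rightarrow> ('a \<Rightarrow> 'a \<Rightarrow> 'a) \<Rightarrow> bool" where
  "solvable_alg V br \<longleftrightarrow> (\<exists>m. derived_series V br m = {0})"

definition ideal_of :: "'a::real_vector set \<Rightarrow> ('a \<Rightarrow> 'a \<Rightarrow> 'a) \<Rightarrow> 'a set \<Rightarrow> bool" where
  "ideal_of V br I \<longleftrightarrow>
     subspace I \<and> I \<subseteq> V \<and> (\<forall>x\<in>V. \<forall>y\<in>I. br x y \<in> I \<and> br y x \<in> I)"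

definition maximal_nilpotent_ideal ::
    "'a::real_vector set \<Rightarrow> ('a \<Rightarrow> 'a \<Rightarrow> 'a) \<Rightarrow> 'a set \<Rightarrow> bool" where
  "maximal_nilpotent_ideal V br N \<longleftrightarrow>
     ideal_of V br N \<and> nilpotent_alg N br \<and>
     (\<forall>M. ideal_of V br M \<and> nilpotent_alg M br \<and> N \<subseteq> M \<longrightarrow> M = N)"

definition is_nilradical :: "'a::real_vector set \<Rightarrow> ('a \<Rightarrow> 'a \<Rightarrow> 'a) \<Rightarrow> 'a set \<Rightarrow> bool" where
  "is_nilradical V br N \<longleftrightarrow>
     maximal_nilpotent_ideal V br N \<and> (\<forall>M. maximal_nilpotent_ideal V br M \<longrightarrow> M = N)"

definition indecomposable_alg :: "'a::real_vector set \<Rightarrow> ('a \<Rightarrow> 'a \<Rightarrow> 'a) \<Rightarrow> bool" where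
  "indecomposable_alg V br \<longleftrightarrow>
     \<not> (\<exists>I J. ideal_of V br I \<and> ideal_of V br J \<and> I \<noteq> {0} \<and> J \<noteq> {0} \<and>
             I \<inter> J = {0} \<and> V = {x + y | x y. x \<in> I \<and> y \<in> J})"

(* Only the restriction of f to V matters; asking f to be linear on the whole ambient space is no
   loss, since a linear map on a subspace extends. *)
definition alg_isomorphic ::
    "'a::real_vector set \<Rightarrow> ('a \<Rightarrow> 'a \<Rightarrow> 'a) \<Rightarrow> 'b::real_vector set \<Rightarrow> ('b \<Rightarrow> 'b \<Rightarrow> 'b) \<Rightarrow> bool" where
  "alg_isomorphic V br W cr \<longleftrightarrow>
     (\<exists>f. linear f \<and> bij_betw f V W \<and> (\<forall>x\<in>V. \<forall>y\<in>V. f (br x y) = cr (f x) (f y)))"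

(* The concrete algebras live in the finitely supported functions nat => real, with basis
   vectors e 1, e 2, ... *)

abbreviation e :: "nat \<Rightarrow> (nat \<Rightarrow>\<^sub>0 real)" where
  "e i \<equiv> Poly_Mapping.single i 1"

definition coord_space :: "nat \<Rightarrow> (nat \<Rightarrow>\<^sub>0 real) set" where
  "coord_space m = span (e ` {1..m})"

(* The bilinear extension of a multiplication table: T i j is the bracket of e i and e j. *)
definition table_bracket ::
    "(nat \<Rightarrow> nat \<Rightarrow> (nat \<Rightarrow>\<^sub>0 real)) \<Rightarrow> (nat \<Rightarrow>\<^sub>0 real) \<Rightarrow> (nat \<Rightarrow>\<^sub>0 real) \<Rightarrow> (nat \<Rightarrow>\<^sub>0 real)" where
  "table_bracket T x y =
     (\<Sum>i\<in>Poly_Mapping.keys x. \<Sum>j\<in>Poly_Mapping.keys y.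
        (Poly_Mapping.lookup x i * Poly_Mapping.lookup y j) *\<^sub>R T i j)"

lemma table_bracket_basis: "table_bracket T (e i) (e j) = T i j"
  by (simp add: table_bracket_def)

definition L2_table :: "nat \<Rightarrow> nat \<Rightarrow> nat \<Rightarrow> (nat \<Rightarrow>\<^sub>0 real)" where
  "L2_table n i j =
     (if i = 1 \<and> j = 1 then e 2
      else if 3 \<le> i \<and> i < n \<and> j = 1 then e (i + 1)
      else if i = 1 \<and> j = 3 then e 2 - e 4
      else if i = 1 \<and> 4 \<le> j \<and> j < n then - e (j + 1)
      else 0)"

definition L2_bracket :: "nat \<Rightarrow> (nat \<Rightarrow>\<^sub>0 real) \<Rightarrow> (nat \<Rightarrow>\<^sub>0 real) \<Rightarrow> (nat \<Rightarrow>\<^sub>0 real)" where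
  "L2_bracket n = table_bracket (L2_table n)"

(* The algebra l_{n+2,1}; n is the dimension of its nilradical. *)
definition l_table :: "nat \<Rightarrow> nat \<Rightarrow> nat \<Rightarrow> (nat \<Rightarrow>\<^sub>0 real)" where
  "l_table n i j =
     (if i \<le> n \<and> j \<le> n then L2_table n i j
      else if i \<le> n \<and> j = n + 1 then
        (if i = 1 then e 1 - 2 *\<^sub>R e 3
         else if i = 3 then - e 3
         else if i = 4 then e 2
         else if 5 \<le> i then (real i - 4) *\<^sub>R e i
         else 0)
      else if i = n + 1 \<and> j \<le> n then
        (if j = 1 then - e 1 + 2 *\<^sub>R e 3
         else if 3 \<le> j then (4 - real j) *\<^sub>R e j
         else 0)
      else if i \<le> n \<and> j = n + 2 then
        (if i = 1 then e 1
         else if i = 3 then e 3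
         else if i = 4 then - e 2 + 2 *\<^sub>R e 4
         else if 5 \<le> i then (real i - 2) *\<^sub>R e i
         else 0)
      else if i = n + 2 \<and> j \<le> n then
        (if j = 1 then - e 1
         else if j = 2 then - (2 *\<^sub>R e 2)
         else if 3 \<le> j then (2 - real j) *\<^sub>R e j
         else 0)
      else 0)"

definition l_bracket :: "nat \<Rightarrow> (nat \<Rightarrow>\<^sub>0 real) \<Rightarrow> (nat \<Rightarrow>\<^sub>0 real) \<Rightarrow> (nat \<Rightarrow>\<^sub>0 real)" where
  "l_bracket n = table_bracket (l_table n)"

(* For n > 0 the condition on dim forces V to be finite dimensional: dim is 0 on infinite
   dimensional subspaces. *)
definition solvable_indecomposable_with_nilradical_L2 ::
    "nat \<Rightarrow> 'a::real_vector set \<Rightarrow> ('a \<Rightarrow> 'a \<Rightarrow> 'a) \<Rightarrow> bool" where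
  "solvable_indecomposable_with_nilradical_L2 n V br \<longleftrightarrow>
     left_leibniz V br \<and> dim V = n + 2 \<and> solvable_alg V br \<and> indecomposable_alg V br \<and>
     (\<exists>N. is_nilradical V br N \<and> alg_isomorphic N br (coord_space n) (L2_bracket n))"

end

theory Submission
  imports Defs
begin

text \<open>Replace \<open>e_1\<close> by \<open>u = e_1 - e_3\<close> and put \<open>w = e_3\<close>, \<open>z = e_2\<close>, \<open>c_k = e_{k+4}\<close>.  Then \<open>\<L>\<^sup>2\<close> is
  generated by \<open>u\<close> and \<open>w\<close>, with \<open>[u,u] = [w,w] = 0\<close>, and is a central extension by \<open>z = [u,w] + [w,u]\<close>
  of a graded filiform Lie algebra.  Since \<open>[u,u] = [w,w] = 0\<close> while \<open>z \<noteq> 0\<close>, every derivation is triangular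
  with diagonal entries \<open>\<alpha>\<close> on \<open>u\<close>, \<open>\<beta>\<close> on \<open>w\<close>, \<open>\<alpha> + \<beta>\<close> on \<open>z\<close> and \<open>(k+1)\<alpha> + \<beta>\<close> on \<open>c_k\<close>.

  Let \<open>L\<close> be a solvable Leibniz algebra with nilradical \<open>N = \<L>\<^sup>2\<close> of codimension two.  Elements of \<open>L\<close>
  whose left multiplication has \<open>\<alpha> = \<beta> = 0\<close> act nilpotently on \<open>N\<close> from both sides, so maximality of \<open>N\<close>
  puts them in \<open>N\<close>; hence \<open>(\<alpha>, \<beta>)\<close> identifies \<open>L/N\<close> with the plane.  Choose \<open>h\<close> with weights \<open>(1,3)\<close>.  All
  its weights on \<open>N\<close> are nonzero, so the kernel of \<open>[h,_]\<close> is a complement of \<open>N\<close> with zero bracket.  The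
  weights of \<open>u\<close> and \<open>w\<close> are simple, so \<open>u\<close> and \<open>w\<close> can be corrected to common eigenvectors of this complement,
  and all remaining brackets follow from the Leibniz identity.

  Conversely, in \<open>l_{n+2,1}\<close> right multiplication by an element outside \<open>N\<close> is not nilpotent on the ideal it
  generates, and the weight space of \<open>u\<close> is a line, which forces \<open>u\<close> into one summand of any decomposition.\<close>

section \<open>The nilpotent algebra\<close>

lemma linear_span_in:
  assumes "linear f" and x: "x \<in> span A" and "subspace S" and "\<And>a. a \<in> A \<Longrightarrow> f a \<in> S"
  shows "f x \<in> S"
proof -
  have "f x \<in> span (f ` A)"
    using x linear_span_image[OF assms(1), of A] by blast
  also have "\<dots> \<subseteq> S" using assms(3,4) by (intro span_minimal) auto
  finally show ?thesis .
qed

locale bilin =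
  fixes br :: "'a::real_vector \<Rightarrow> 'a \<Rightarrow> 'a" (infixl "\<cdot>" 70)
  assumes add_left: "(x + y) \<cdot> v = x \<cdot> v + y \<cdot> v"
    and add_right: "x \<cdot> (y + v) = x \<cdot> y + x \<cdot> v"
    and scale_left: "(r *\<^sub>R x) \<cdot> y = r *\<^sub>R (x \<cdot> y)"
    and scale_right: "x \<cdot> (r *\<^sub>R y) = r *\<^sub>R (x \<cdot> y)"
begin

lemma zero_left [simp]: "0 \<cdot> y = 0"
  using scale_left[of 0 0 y] by simp

lemma zero_right [simp]: "y \<cdot> 0 = 0"
  using scale_right[of y 0 0] by simp

lemma minus_left: "(- x) \<cdot> y = - (x \<cdot> y)"
  using scale_left[of "-1" x y] by simp

lemma minus_right: "x \<cdot> (- y) = - (x \<cdot> y)"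
  using scale_right[of x "-1" y] by simp

lemma diff_left: "(x - y) \<cdot> v = x \<cdot> v - y \<cdot> v"
  using add_left[of x "- y" v] by (simp add: minus_left)

lemma diff_right: "x \<cdot> (y - v) = x \<cdot> y - x \<cdot> v"
  using add_right[of x y "- v"] by (simp add: minus_right)

lemmas bilin_simps =
  add_left add_right scale_left scale_right minus_left minus_right diff_left diff_right

lemma linear_left: "linear (\<lambda>x. x \<cdot> y)"
  by (rule linearI) (simp_all add: bilin_simps)

lemma linear_right: "linear (\<lambda>y. x \<cdot> y)"
  by (rule linearI) (simp_all add: bilin_simps)

lemma span_bracket_in:
  assumes "subspace S" and "\<And>x y. x \<in> A \<Longrightarrow> y \<in> B \<Longrightarrow> x \<cdot> y \<in> S"
    and x: "x \<in> span A" and y: "y \<in> span B"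
  shows "x \<cdot> y \<in> S"
proof -
  have "x \<cdot> b \<in> S" if "b \<in> B" for b
    using assms(2) that by (intro linear_span_in[OF linear_left x assms(1)])
  then show ?thesis by (intro linear_span_in[OF linear_right y assms(1)])
qed

end

text \<open>The sequence \<open>c\<close> runs over all naturals and vanishes from \<open>m\<close>
  on, so \<open>c k \<cdot> u = c (Suc k)\<close> needs no case for the last basis vector; for
  \<open>\<L>\<^sup>2\<close> one has \<open>m = n - 3\<close>. Linear independence is kept apart
  and enters through the functionals of \<open>L2_dual\<close>.\<close>

locale L2_tab = bilin br for br :: "'a::real_vector \<Rightarrow> 'a \<Rightarrow> 'a" (infixl "\<cdot>" 70) +
  fixes u w z :: 'a and c :: "nat \<Rightarrow> 'a" and m :: nat
  assumes uu: "u \<cdot> u = 0" and uw: "u \<cdot> w = z - c 0" and wu: "w \<cdot> u = c 0" and ww: "w \<cdot> w = 0"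
    and uz: "u \<cdot> z = 0" and zu: "z \<cdot> u = 0" and wz: "w \<cdot> z = 0" and zw: "z \<cdot> w = 0"
    and zz: "z \<cdot> z = 0"
    and uc: "u \<cdot> c k = - c (Suc k)" and cu: "c k \<cdot> u = c (Suc k)"
    and wc: "w \<cdot> c k = 0" and cw: "c k \<cdot> w = 0" and zc: "z \<cdot> c k = 0" and cz: "c k \<cdot> z = 0"
    and cc: "c k \<cdot> c l = 0"
    and c_eq_0: "m \<le> k \<Longrightarrow> c k = 0"
begin

lemmas L2_simps = uu uw wu ww uz zu wz zw zz uc cu wc cw zc cz cc

text \<open>\<open>F\<close> is the derived algebra of \<open>N\<close>; \<open>G\<close> filters
  the span of \<open>c\<close>, and right multiplication by \<open>N\<close> raises its
  index.\<close>

definition G :: "nat \<Rightarrow> 'a set" where "G k = span (c ` {k..})"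
definition F :: "'a set" where "F = span (insert z (range c))"
definition N :: "'a set" where "N = span (insert u (insert w (insert z (range c))))"

lemma subspace_G [simp]: "subspace (G k)" and subspace_F [simp]: "subspace F"
  and subspace_N [simp]: "subspace N"
  by (simp_all add: G_def F_def N_def)

lemma basis_in [simp]: "u \<in> N" "w \<in> N" "z \<in> N" "c k \<in> N" "z \<in> F" "c k \<in> F"
  by (auto simp: N_def F_def intro: span_base)

lemma c_in_G: "j \<le> k \<Longrightarrow> c k \<in> G j"
  by (auto simp: G_def intro: span_base)

lemma zero_in [simp]: "0 \<in> N" "0 \<in> F" "0 \<in> G k"
  by (simp_all add: subspace_0)

lemma F_subset_N: "F \<subseteq> N"
  unfolding F_def N_def by (rule span_mono) auto

lemma G_subset_F: "G k \<subseteq> F"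
  unfolding F_def G_def by (rule span_mono) auto

lemma G_mono: "j \<le> k \<Longrightarrow> G k \<subseteq> G j"
  unfolding G_def by (rule span_mono) auto

lemma G_trivial: "m \<le> k \<Longrightarrow> G k = {0}"
proof -
  assume "m \<le> k"
  then have "c ` {k..} \<subseteq> {0}" by (auto simp: c_eq_0)
  then have "G k \<subseteq> {0}" unfolding G_def by (rule span_minimal) simp
  then show ?thesis by auto
qed

lemma N_cases:
  assumes "x \<in> N" obtains a b f where "f \<in> F" "x = a *\<^sub>R u + b *\<^sub>R w + f"
proof -
  from assms obtain a where "x - a *\<^sub>R u \<in> span (insert w (insert z (range c)))"
    unfolding N_def span_insert[of u] by auto
  then obtain b where "x - a *\<^sub>R u - b *\<^sub>R w \<in> F"
    unfolding F_def span_insert[of w] by auto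
  then show thesis by (intro that[of "x - a *\<^sub>R u - b *\<^sub>R w" a b]) auto
qed

lemma F_cases:
  assumes "x \<in> F" obtains d g where "g \<in> G 0" "x = d *\<^sub>R z + g"
proof -
  from assms obtain d where "x - d *\<^sub>R z \<in> G 0"
    unfolding F_def G_def span_insert[of z] by (auto simp: atLeast_0)
  then show thesis by (intro that[of "x - d *\<^sub>R z" d]) auto
qed

lemma G_cases:
  assumes "x \<in> G k" obtains a g where "g \<in> G (Suc k)" "x = a *\<^sub>R c k + g"
proof -
  have "{k..} = insert k {Suc k..}" by auto
  then have "c ` {k..} = insert (c k) (c ` {Suc k..})" by (metis image_insert)
  with assms obtain a where "x - a *\<^sub>R c k \<in> G (Suc k)"
    unfolding G_def using span_insert[of "c k" "c ` {Suc k..}"] by auto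
  then show thesis by (intro that[of "x - a *\<^sub>R c k" a]) auto
qed

lemma NI: "f \<in> F \<Longrightarrow> a *\<^sub>R u + b *\<^sub>R w + f \<in> N"
  using F_subset_N by (auto intro!: subspace_add subspace_scale)

lemma F_F: "x \<in> F \<Longrightarrow> y \<in> F \<Longrightarrow> x \<cdot> y = 0"
proof -
  assume "x \<in> F" "y \<in> F"
  then have "x \<cdot> y \<in> {0}"
    unfolding F_def by (rule span_bracket_in[rotated 2]) (auto simp: L2_simps)
  then show ?thesis by simp
qed

lemma F_w: "x \<in> F \<Longrightarrow> x \<cdot> w = 0"
proof -
  assume "x \<in> F"
  then have "x \<cdot> w \<in> {0}"
    unfolding F_def by (rule linear_span_in[OF linear_left]) (auto simp: L2_simps)
  then show ?thesis by simp
qed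

lemma w_F: "x \<in> F \<Longrightarrow> w \<cdot> x = 0"
proof -
  assume "x \<in> F"
  then have "w \<cdot> x \<in> {0}"
    unfolding F_def by (rule linear_span_in[OF linear_right]) (auto simp: L2_simps)
  then show ?thesis by simp
qed

lemma F_u: "x \<in> F \<Longrightarrow> x \<cdot> u \<in> G 1"
  unfolding F_def
  by (rule linear_span_in[OF linear_left]) (auto simp: L2_simps intro: c_in_G)

lemma G_u: "x \<in> G k \<Longrightarrow> x \<cdot> u \<in> G (Suc k)"
  unfolding G_def[of k]
  by (rule linear_span_in[OF linear_left]) (auto simp: L2_simps intro: c_in_G)

lemma u_F: "x \<in> F \<Longrightarrow> u \<cdot> x = - (x \<cdot> u)"
proof -
  assume x: "x \<in> F"
  then have "u \<cdot> x + x \<cdot> u \<in> {0}"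
    unfolding F_def
    by (rule linear_span_in[OF linear_compose_add[OF linear_right linear_left]]) (auto simp: L2_simps)
  then show ?thesis by (simp add: eq_neg_iff_add_eq_0)
qed

text \<open>Skew symmetry fails in \<open>N\<close> only for the pair \<open>u\<close>,
  \<open>w\<close>, whose symmetrized bracket is \<open>z\<close>; a factor from \<open>F\<close>
  avoids this pair.\<close>

lemma N_F_skew: "y \<in> N \<Longrightarrow> x \<in> F \<Longrightarrow> y \<cdot> x = - (x \<cdot> y)"
  by (erule N_cases) (simp add: bilin_simps u_F w_F F_w F_F)

lemma F_N: "x \<in> F \<Longrightarrow> y \<in> N \<Longrightarrow> x \<cdot> y \<in> G 1"
  by (erule N_cases) (simp add: bilin_simps F_w F_F F_u[unfolded One_nat_def] subspace_scale)

lemma G_N: "x \<in> G k \<Longrightarrow> y \<in> N \<Longrightarrow> x \<cdot> y \<in> G (Suc k)"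
proof (erule N_cases)
  fix a b f assume x: "x \<in> G k" and "f \<in> F" "y = a *\<^sub>R u + b *\<^sub>R w + f"
  moreover have "x \<in> F" using x G_subset_F by auto
  ultimately show ?thesis by (simp add: bilin_simps F_w F_F G_u subspace_scale)
qed

lemma N_N: "x \<in> N \<Longrightarrow> y \<in> N \<Longrightarrow> x \<cdot> y \<in> F"
  unfolding N_def
  by (erule span_bracket_in[rotated 2], assumption)
    (auto simp: L2_simps subspace_diff subspace_neg)

end

section \<open>The extension by a torus\<close>

lemma subspace_bracket_span [simp]: "subspace (bracket_span br A B)"
  by (simp add: bracket_span_def)

lemma in_bracket_span: "x \<in> A \<Longrightarrow> y \<in> B \<Longrightarrow> br x y \<in> bracket_span br A B"
  unfolding bracket_span_def by (rule span_base) auto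

text \<open>Linearity of the Leibniz defect in each argument reduces the identity on a span to
  triples of generators.\<close>

lemma (in bilin) linear_leibniz_defect:
  "linear (\<lambda>x. x \<cdot> y \<cdot> v - x \<cdot> (y \<cdot> v) + y \<cdot> (x \<cdot> v))"
  "linear (\<lambda>y. x \<cdot> y \<cdot> v - x \<cdot> (y \<cdot> v) + y \<cdot> (x \<cdot> v))"
  "linear (\<lambda>v. x \<cdot> y \<cdot> v - x \<cdot> (y \<cdot> v) + y \<cdot> (x \<cdot> v))"
  by (auto intro!: linearI simp: bilin_simps algebra_simps)

text \<open>From the left, \<open>s\<close> and \<open>t\<close> act diagonally with
  \<open>(\<alpha>, \<beta>)\<close> equal to \<open>(1, 0)\<close> and \<open>(0, 1)\<close>. From
  the right, \<open>t\<close> is not diagonal in this basis: expanding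
  \<open>w \<cdot> u \<cdot> t\<close> by the Leibniz identity gives
  \<open>c 0 \<cdot> t = u \<cdot> w = z - c 0\<close>.\<close>

locale l_tab = L2_tab br u w z c m
  for br :: "'a::real_vector \<Rightarrow> 'a \<Rightarrow> 'a" (infixl "\<cdot>" 70) and u w z c m +
  fixes s t :: 'a
  assumes ss: "s \<cdot> s = 0" and st: "s \<cdot> t = 0" and ts: "t \<cdot> s = 0" and tt: "t \<cdot> t = 0"
    and su: "s \<cdot> u = u" and us: "u \<cdot> s = - u" and tu: "t \<cdot> u = 0" and ut: "u \<cdot> t = 0"
    and sw: "s \<cdot> w = 0" and ws: "w \<cdot> s = 0" and tw: "t \<cdot> w = w" and wt: "w \<cdot> t = - w"
    and sz: "s \<cdot> z = z" and zs: "z \<cdot> s = 0" and tz: "t \<cdot> z = z" and zt: "z \<cdot> t = 0"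
    and sc: "s \<cdot> c k = real (Suc k) *\<^sub>R c k" and cs: "c k \<cdot> s = - real (Suc k) *\<^sub>R c k"
    and tc: "t \<cdot> c k = c k" and ct: "c k \<cdot> t = (if k = 0 then z else 0) - c k"
begin

lemmas l_simps = L2_simps ss st ts tt su us tu ut sw ws tw wt sz zs tz zt sc cs tc ct

definition V :: "'a set"
  where "V = span (insert s (insert t (insert u (insert w (insert z (range c))))))"

lemma subspace_V [simp]: "subspace V"
  by (simp add: V_def)

lemma basis_in_V [simp]: "s \<in> V" "t \<in> V" "u \<in> V" "w \<in> V" "z \<in> V" "c k \<in> V"
  by (auto simp: V_def intro: span_base)

lemma N_subset_V: "N \<subseteq> V"
  unfolding N_def V_def by (rule span_mono) auto

lemma V_cases:
  assumes "x \<in> V" obtains a b y where "y \<in> N" "x = a *\<^sub>R s + b *\<^sub>R t + y"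
proof -
  from assms obtain a where
    "x - a *\<^sub>R s \<in> span (insert t (insert u (insert w (insert z (range c)))))"
    unfolding V_def span_insert[of s] by auto
  then obtain b where "x - a *\<^sub>R s - b *\<^sub>R t \<in> N"
    unfolding N_def span_insert[of t] by auto
  then show thesis by (intro that[of "x - a *\<^sub>R s - b *\<^sub>R t" a b]) auto
qed

lemma V_V: "x \<in> V \<Longrightarrow> y \<in> V \<Longrightarrow> x \<cdot> y \<in> N"
  unfolding V_def
  by (erule span_bracket_in[rotated 2], assumption)
    (auto simp: l_simps subspace_diff subspace_neg subspace_scale)

lemma leibniz_V:
  assumes x: "x \<in> V" and y: "y \<in> V" and v: "v \<in> V"
  shows "x \<cdot> y \<cdot> v = x \<cdot> (y \<cdot> v) - y \<cdot> (x \<cdot> v)"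
proof -
  let ?B = "insert s (insert t (insert u (insert w (insert z (range c)))))"
  have 3: "x \<cdot> y \<cdot> v - x \<cdot> (y \<cdot> v) + y \<cdot> (x \<cdot> v) \<in> {0}" if "x \<in> ?B" "y \<in> ?B" "v \<in> ?B" for x y v
    using that by (auto simp: l_simps bilin_simps algebra_simps scaleR_2)
  have 2: "x \<cdot> y \<cdot> v - x \<cdot> (y \<cdot> v) + y \<cdot> (x \<cdot> v) \<in> {0}" if "y \<in> ?B" "v \<in> ?B" for y v
    by (rule linear_span_in[OF linear_leibniz_defect(1) x[unfolded V_def]]) (use 3 that in auto)
  have 1: "x \<cdot> y \<cdot> v - x \<cdot> (y \<cdot> v) + y \<cdot> (x \<cdot> v) \<in> {0}" if "v \<in> ?B" for v
    by (rule linear_span_in[OF linear_leibniz_defect(2) y[unfolded V_def]]) (use 2 that in auto)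
  have "x \<cdot> y \<cdot> v - x \<cdot> (y \<cdot> v) + y \<cdot> (x \<cdot> v) \<in> {0}"
    by (rule linear_span_in[OF linear_leibniz_defect(3) v[unfolded V_def]]) (use 1 in auto)
  then show ?thesis by (simp add: algebra_simps)
qed

lemma left_leibniz_V: "left_leibniz V br"
  using V_V N_subset_V by (auto simp: left_leibniz_def leibniz_V bilin_simps)

section \<open>Derived and lower central series of the extension\<close>

lemma bracket_span_V_V: "bracket_span br V V = N"
proof
  show "bracket_span br V V \<subseteq> N"
    unfolding bracket_span_def by (rule span_minimal) (use V_V in auto)
  have "s \<cdot> u \<in> bracket_span br V V" "t \<cdot> w \<in> bracket_span br V V" "s \<cdot> z \<in> bracket_span br V V"
    "t \<cdot> c k \<in> bracket_span br V V" for k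
    by (auto intro: in_bracket_span)
  then show "N \<subseteq> bracket_span br V V"
    unfolding N_def by (intro span_minimal) (auto simp: l_simps)
qed

lemma bracket_span_N_V: "bracket_span br N V = N"
proof
  show "bracket_span br N V \<subseteq> N"
    unfolding bracket_span_def by (rule span_minimal) (use V_V N_subset_V in auto)
  have 1: "u \<cdot> s \<in> bracket_span br N V" "w \<cdot> t \<in> bracket_span br N V"
    "c 0 \<cdot> t \<in> bracket_span br N V" "c k \<cdot> s \<in> bracket_span br N V" for k
    by (auto intro: in_bracket_span)
  have c: "c k \<in> bracket_span br N V" for k
  proof -
    have "c k = (- 1 / real (Suc k)) *\<^sub>R (c k \<cdot> s)" by (simp add: cs del: of_nat_Suc)
    then show ?thesis using 1(4)[of k] by (metis subspace_bracket_span subspace_scale)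
  qed
  \<comment> \<open>Right multiplication by the torus kills \<open>z\<close>, so \<open>z\<close> is
    obtained as \<open>c 0 \<cdot> t + c 0\<close>.\<close>
  have "u \<in> bracket_span br N V" "w \<in> bracket_span br N V" "z \<in> bracket_span br N V"
    using subspace_neg[OF _ 1(1)] subspace_neg[OF _ 1(2)] subspace_add[OF _ 1(3) c[of 0]]
    by (simp_all add: l_simps)
  with c show "N \<subseteq> bracket_span br N V"
    unfolding N_def by (intro span_minimal) auto
qed

lemma bracket_span_N_N: "bracket_span br N N = F"
proof
  show "bracket_span br N N \<subseteq> F"
    unfolding bracket_span_def by (rule span_minimal) (use N_N in auto)
  have 1: "w \<cdot> u \<in> bracket_span br N N" "u \<cdot> w \<in> bracket_span br N N" "c k \<cdot> u \<in> bracket_span br N N" for k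
    by (auto intro: in_bracket_span)
  have "c k \<in> bracket_span br N N" for k
    using 1 by (cases k) (simp_all add: L2_simps)
  moreover have "z \<in> bracket_span br N N"
    using subspace_add[OF _ 1(1,2)] by (simp add: L2_simps)
  ultimately show "F \<subseteq> bracket_span br N N"
    unfolding F_def by (intro span_minimal) auto
qed

lemma bracket_span_F_F: "bracket_span br F F = {0}"
proof -
  have "bracket_span br F F \<subseteq> {0}"
    unfolding bracket_span_def by (rule span_minimal) (auto simp: F_F)
  then show ?thesis using subspace_0[OF subspace_bracket_span] by blast
qed

lemma derived_series_V:
  "derived_series V br 1 = N" "derived_series V br 2 = F" "derived_series V br (k + 3) = {0}"
proof -
  show 1: "derived_series V br 1 = N" by (simp add: bracket_span_V_V)
  show 2: "derived_series V br 2 = F"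
    using 1 by (simp add: numeral_2_eq_2 bracket_span_N_N bracket_span_V_V)
  show "derived_series V br (k + 3) = {0}"
  proof (induction k)
    case 0
    then show ?case using 2 by (simp add: numeral_3_eq_3 numeral_2_eq_2 bracket_span_F_F)
  next
    case (Suc k)
    have "bracket_span br {0} {0} \<subseteq> {0}"
      unfolding bracket_span_def by (rule span_minimal) auto
    then have "bracket_span br {0} {0} = {0}" using subspace_0[OF subspace_bracket_span] by blast
    with Suc show ?case by (simp only: add_Suc derived_series.simps)
  qed
qed

lemma solvable_V: "solvable_alg V br"
  unfolding solvable_alg_def using derived_series_V(3) by blast

lemma lower_central_V: "lower_central V br (Suc k) = N"
  by (induction k) (simp_all add: bracket_span_V_V bracket_span_N_V)

lemma ideal_N: "ideal_of V br N"
  unfolding ideal_of_def using V_V N_subset_V by auto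

lemma tF: "f \<in> F \<Longrightarrow> t \<cdot> f = f"
proof -
  assume "f \<in> F"
  then have "t \<cdot> f - f \<in> {0}"
    unfolding F_def
    by (rule linear_span_in[OF linear_compose_sub[OF linear_right linear_ident]]) (auto simp: l_simps)
  then show ?thesis by simp
qed

text \<open>Left multiplication by \<open>t\<close> is the identity on \<open>w\<close> and
  \<open>F\<close>, so \<open>t \<cdot> x = 0\<close> leaves only the coordinates at
  \<open>s\<close>, \<open>t\<close>, \<open>u\<close>. Left multiplication by \<open>s\<close>
  fixes \<open>u\<close> and kills \<open>s\<close> and \<open>t\<close>.\<close>

lemma weight_space_u:
  assumes "x \<in> V" "s \<cdot> x = x" "t \<cdot> x = 0"
  obtains a where "x = a *\<^sub>R u"
proof -
  from assms(1) obtain p q y where yN: "y \<in> N" and x: "x = p *\<^sub>R s + q *\<^sub>R t + y" by (rule V_cases)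
  from yN obtain a b f where f: "f \<in> F" and y: "y = a *\<^sub>R u + b *\<^sub>R w + f" by (rule N_cases)
  have "b *\<^sub>R w + f = t \<cdot> x"
    using f by (simp add: x y bilin_simps l_simps tF)
  then have f: "b *\<^sub>R w + f = 0" using assms by simp
  then have "x = p *\<^sub>R s + q *\<^sub>R t + a *\<^sub>R u" by (simp add: x y add.assoc)
  with assms(2) have "x = a *\<^sub>R u" by (metis add_0 bilin_simps(2,4) scaleR_zero_right ss st su)
  then show thesis by (rule that)
qed

end

section \<open>Nilpotency of \<open>N\<close> and coordinate functionals\<close>

context L2_tab begin

text \<open>The first bracket lands in \<open>F\<close>, the second in \<open>G 1\<close>, and each
  further one raises the index until it passes \<open>m\<close>.\<close>

lemma nilpotent_N: "nilpotent_alg N br"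
proof -
  have 1: "lower_central N br 1 \<subseteq> F"
    unfolding One_nat_def lower_central.simps bracket_span_def
    by (rule span_minimal) (use N_N in auto)
  have "lower_central N br (k + 2) \<subseteq> G (k + 1)" for k
  proof (induction k)
    case 0
    have "lower_central N br 2 = bracket_span br (lower_central N br 1) N"
      by (simp add: numeral_2_eq_2)
    also have "\<dots> \<subseteq> G 1"
      unfolding bracket_span_def by (rule span_minimal) (use 1 F_N in auto)
    finally show ?case by (simp only: add_0)
  next
    case (Suc k)
    have "lower_central N br (Suc k + 2) = bracket_span br (lower_central N br (k + 2)) N"
      by simp
    also have "\<dots> \<subseteq> G (Suc k + 1)"
      unfolding bracket_span_def by (rule span_minimal) (use Suc G_N in auto)
    finally show ?case .
  qed
  from this[of m] have "lower_central N br (m + 2) \<subseteq> {0}" by (simp add: G_trivial)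
  moreover have "0 \<in> lower_central N br (m + 2)" by (simp add: subspace_0)
  ultimately show ?thesis unfolding nilpotent_alg_def by blast
qed

end

text \<open>Coordinate functionals state the independence of the basis in a form that rewriting can
  use. The condition \<open>k < m\<close> matches \<open>c k = 0\<close> from \<open>m\<close> on,
  and \<open>0 < m\<close> makes \<open>c 0\<close> nonzero.\<close>

locale L2_dual = L2_tab br u w z c m
  for br :: "'a::real_vector \<Rightarrow> 'a \<Rightarrow> 'a" (infixl "\<cdot>" 70) and u w z c m +
  fixes pu pw pz :: "'a \<Rightarrow> real" and pc :: "nat \<Rightarrow> 'a \<Rightarrow> real"
  assumes linear_p: "linear pu" "linear pw" "linear pz" "linear (pc k)"
    and pu: "pu u = 1" "pu w = 0" "pu z = 0" "pu (c k) = 0"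
    and pw: "pw u = 0" "pw w = 1" "pw z = 0" "pw (c k) = 0"
    and pz: "pz u = 0" "pz w = 0" "pz z = 1" "pz (c k) = 0"
    and pc: "pc j u = 0" "pc j w = 0" "pc j z = 0" "pc j (c k) = (if j = k \<and> k < m then 1 else 0)"
    and m_pos: "0 < m"
begin

lemmas p_simps = pu pw pz pc
  linear_add[OF linear_p(1)] linear_add[OF linear_p(2)] linear_add[OF linear_p(3)]
  linear_add[OF linear_p(4)]
  linear_diff[OF linear_p(1)] linear_diff[OF linear_p(2)] linear_diff[OF linear_p(3)]
  linear_diff[OF linear_p(4)]
  linear_neg[OF linear_p(1)] linear_neg[OF linear_p(2)] linear_neg[OF linear_p(3)]
  linear_neg[OF linear_p(4)]
  linear_scale[OF linear_p(1)] linear_scale[OF linear_p(2)] linear_scale[OF linear_p(3)]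
  linear_scale[OF linear_p(4)]
  linear_0[OF linear_p(1)] linear_0[OF linear_p(2)] linear_0[OF linear_p(3)]
  linear_0[OF linear_p(4)]

lemma pu_F: "f \<in> F \<Longrightarrow> pu f = 0"
  unfolding F_def using linear_span_in[OF linear_p(1), of f _ "{0}"] by (fastforce simp: p_simps)

lemma pw_F: "f \<in> F \<Longrightarrow> pw f = 0"
  unfolding F_def using linear_span_in[OF linear_p(2), of f _ "{0}"] by (fastforce simp: p_simps)

lemma pz_G: "f \<in> G k \<Longrightarrow> pz f = 0"
  unfolding G_def using linear_span_in[OF linear_p(3), of f _ "{0}"] by (fastforce simp: p_simps)

lemma pc_G: "f \<in> G (Suc k) \<Longrightarrow> pc k f = 0"
proof -
  assume "f \<in> G (Suc k)"
  then have "pc k f \<in> {0}"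
    unfolding G_def by (rule linear_span_in[OF linear_p(4)]) (auto simp: p_simps)
  then show ?thesis by simp
qed

end

locale l_dual = l_tab br u w z c m s t + L2_dual br u w z c m pu pw pz pc
  for br :: "'a::real_vector \<Rightarrow> 'a \<Rightarrow> 'a" (infixl "\<cdot>" 70) and u w z c m s t pu pw pz pc +
  fixes ps pt :: "'a \<Rightarrow> real"
  assumes linear_st: "linear ps" "linear pt"
    and ps: "ps s = 1" "ps t = 0" "ps u = 0" "ps w = 0" "ps z = 0" "ps (c k) = 0"
    and pt: "pt s = 0" "pt t = 1" "pt u = 0" "pt w = 0" "pt z = 0" "pt (c k) = 0"
    and p_st: "pu s = 0" "pu t = 0" "pw s = 0" "pw t = 0" "pc j s = 0" "pc j t = 0"
begin

lemmas pst_simps = p_simps ps pt p_st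
  linear_add[OF linear_st(1)] linear_add[OF linear_st(2)]
  linear_neg[OF linear_st(1)] linear_neg[OF linear_st(2)]
  linear_diff[OF linear_st(1)] linear_diff[OF linear_st(2)]
  linear_scale[OF linear_st(1)] linear_scale[OF linear_st(2)]

lemma bilinear_functional_0:
  fixes g :: "'a \<Rightarrow> 'a \<Rightarrow> real"
  assumes "\<And>y. linear (\<lambda>x. g x y)" "\<And>x. linear (\<lambda>y. g x y)"
    and "\<And>x y. x \<in> A \<Longrightarrow> y \<in> B \<Longrightarrow> g x y = 0" and x: "x \<in> span A" and y: "y \<in> span B"
  shows "g x y = 0"
proof -
  have "g x b \<in> {0}" if "b \<in> B" for b
    by (rule linear_span_in[OF assms(1) x]) (use assms(3) that in auto)
  then have "g x y \<in> {0}"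
    by (intro linear_span_in[OF assms(2) y]) auto
  then show ?thesis by simp
qed

text \<open>The span of \<open>t\<close>, \<open>w\<close> and \<open>F\<close> is an ideal of
  \<open>V\<close>; the formula is the bracket of the quotient, the nonabelian Lie algebra on
  \<open>s\<close> and \<open>u\<close>. The pair \<open>t\<close>, \<open>w\<close> gives the
  formula for \<open>pw\<close> in the same way.\<close>

lemma pu_bracket: "x \<in> V \<Longrightarrow> y \<in> V \<Longrightarrow> pu (x \<cdot> y) = ps x * pu y - pu x * ps y"
proof -
  assume "x \<in> V" "y \<in> V"
  then have "pu (x \<cdot> y) - (ps x * pu y - pu x * ps y) = 0"
    unfolding V_def
    by (rule bilinear_functional_0[rotated 3])
      (auto intro!: linearI simp: bilin_simps pst_simps l_simps algebra_simps)
  then show ?thesis by simp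
qed

lemma pw_bracket: "x \<in> V \<Longrightarrow> y \<in> V \<Longrightarrow> pw (x \<cdot> y) = pt x * pw y - pw x * pt y"
proof -
  assume "x \<in> V" "y \<in> V"
  then have "pw (x \<cdot> y) - (pt x * pw y - pw x * pt y) = 0"
    unfolding V_def
    by (rule bilinear_functional_0[rotated 3])
      (auto intro!: linearI simp: bilin_simps pst_simps l_simps algebra_simps)
  then show ?thesis by simp
qed

lemma pc0_bracket_u: "x \<in> V \<Longrightarrow> pc 0 (x \<cdot> u) = pw x"
proof -
  assume "x \<in> V"
  then have "pc 0 (x \<cdot> u) - pw x \<in> {0}"
    unfolding V_def
    by (rule linear_span_in[rotated])
      (use m_pos in \<open>auto intro!: linearI simp: bilin_simps pst_simps l_simps algebra_simps\<close>)
  then show ?thesis by simp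
qed

lemma pc0_bracket_c0: "x \<in> V \<Longrightarrow> pc 0 (x \<cdot> c 0) = ps x + pt x"
proof -
  assume "x \<in> V"
  then have "pc 0 (x \<cdot> c 0) - (ps x + pt x) \<in> {0}"
    unfolding V_def
    by (rule linear_span_in[rotated])
      (use m_pos in \<open>auto intro!: linearI simp: bilin_simps pst_simps l_simps algebra_simps\<close>)
  then show ?thesis by simp
qed

section \<open>Nilradical and indecomposability of the extension\<close>

lemma pst_N: "x \<in> N \<Longrightarrow> ps x = 0" "x \<in> N \<Longrightarrow> pt x = 0"
  unfolding N_def
  using linear_span_in[OF linear_st(1), of x _ "{0}"] linear_span_in[OF linear_st(2), of x _ "{0}"]
  by (fastforce simp: pst_simps)+

lemma in_N_iff: "x \<in> V \<Longrightarrow> x \<in> N \<longleftrightarrow> ps x = 0 \<and> pt x = 0"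
  by (elim V_cases) (auto simp: pst_simps pst_N subspace_add dest: pst_N)

text \<open>Right multiplication by an element outside \<open>N\<close> acts on the coordinate of \<open>u\<close> or of \<open>w\<close>
  by a nonzero scalar, so it is not nilpotent.\<close>

lemma nilpotent_ideal_subset_N:
  assumes M: "ideal_of V br M" and nil: "nilpotent_alg M br"
  shows "M \<subseteq> N"
proof
  fix x assume x: "x \<in> M"
  have MV: "M \<subseteq> V" using M by (simp add: ideal_of_def)
  \<comment> \<open>Here \<open>v\<close> is \<open>u\<close> or \<open>w\<close>, \<open>q\<close>
    its coordinate and \<open>r\<close> the weight of \<open>x\<close> on it. Starting at
    \<open>x \<cdot> v\<close>, which lies in \<open>M\<close>, keeps the iterates in the lower
    central series of \<open>M\<close>.\<close>
  have zero: "r = 0"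
    if v: "v \<in> V" and q: "linear q" "q (x \<cdot> v) = r" "\<And>y. y \<in> N \<Longrightarrow> q (y \<cdot> x) = - r * q y"
    for r :: real and v q
  proof -
    have xv: "x \<cdot> v \<in> M" using M x v by (auto simp: ideal_of_def)
    have N: "x \<cdot> v \<in> N" using V_V x v MV by auto
    have "\<exists>y \<in> lower_central M br k \<inter> N. q y = r * (- r) ^ k" for k
    proof (induction k)
      case 0
      then show ?case using xv q(2) N by auto
    next
      case (Suc k)
      then obtain y where y: "y \<in> lower_central M br k" "y \<in> N" "q y = r * (- r) ^ k" by auto
      have "y \<cdot> x \<in> lower_central M br (Suc k)"
        using y x by (simp add: in_bracket_span)
      moreover have "y \<cdot> x \<in> N" using y x V_V N_subset_V MV by blast
      ultimately show ?case using q(3)[OF y(2)] y(3) by (intro bexI[of _ "y \<cdot> x"]) auto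
    qed
    moreover obtain k where "lower_central M br k = {0}" using nil by (auto simp: nilpotent_alg_def)
    ultimately have "q 0 = r * (- r) ^ k" by (metis IntD1 singletonD)
    then show "r = 0" using linear_0[OF q(1)] by auto
  qed
  have "ps x = 0"
    by (rule zero[OF _ linear_p(1), of u])
      (use x MV N_subset_V in \<open>auto simp: pu_bracket pst_simps pst_N subset_iff\<close>)
  moreover have "pt x = 0"
    by (rule zero[OF _ linear_p(2), of w])
      (use x MV N_subset_V in \<open>auto simp: pw_bracket pst_simps pst_N subset_iff\<close>)
  ultimately show "x \<in> N" using in_N_iff x MV by auto
qed

lemma is_nilradical_N: "is_nilradical V br N"
  using ideal_N nilpotent_N nilpotent_ideal_subset_N
  unfolding is_nilradical_def maximal_nilpotent_ideal_def by blast

text \<open>An ideal containing \<open>u\<close> contains \<open>F\<close>. An element of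
  \<open>J\<close> annihilates \<open>u\<close> and \<open>c 0\<close>, so its coordinates at
  \<open>s\<close>, \<open>t\<close>, \<open>w\<close> vanish; what remains lies in the span of
  \<open>u\<close> and \<open>F\<close>, hence in \<open>I\<close>.\<close>

lemma complement_trivial:
  assumes I: "ideal_of V br I" and J: "ideal_of V br J" and IJ: "I \<inter> J = {0}" and u: "u \<in> I"
  shows "J = {0}"
proof -
  have sI: "subspace I" using I by (simp add: ideal_of_def)
  have cI: "c k \<in> I" for k
  proof (induction k)
    case 0
    have "w \<cdot> u \<in> I" using I u by (simp add: ideal_of_def)
    then show ?case by (simp add: L2_simps)
  next
    case (Suc k)
    then have "c k \<cdot> u \<in> I" using I by (simp add: ideal_of_def)
    then show ?case by (simp add: L2_simps)
  qed
  have "u \<cdot> w + w \<cdot> u \<in> I" using I u by (auto simp: ideal_of_def intro!: subspace_add)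
  then have "z \<in> I" by (simp add: L2_simps)
  with cI have FI: "F \<subseteq> I" unfolding F_def by (intro span_minimal sI) auto
  have "y = 0" if y: "y \<in> J" for y
  proof -
    have yV: "y \<in> V" using y J by (auto simp: ideal_of_def)
    have "y \<cdot> v = 0" if "v \<in> I" for v
    proof -
      have "v \<in> V" using I that by (auto simp: ideal_of_def)
      then have "y \<cdot> v \<in> I \<inter> J" using I J y yV that by (auto simp: ideal_of_def)
      then show ?thesis using IJ by simp
    qed
    then have 0: "y \<cdot> u = 0" "y \<cdot> c 0 = 0" using u cI by auto
    have "ps y = 0" "pw y = 0" "pt y = 0"
      using pu_bracket[OF yV, of u] pc0_bracket_u[OF yV] pc0_bracket_c0[OF yV] unfolding 0
      by (simp_all add: pst_simps)
    moreover from this have "y \<in> N" using in_N_iff yV by auto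
    then obtain a b f where f: "f \<in> F" "y = a *\<^sub>R u + b *\<^sub>R w + f" by (rule N_cases)
    ultimately have "b = 0" by (simp add: pst_simps pw_F)
    then have "y \<in> I" using f FI u sI by (auto intro!: subspace_add subspace_scale)
    then show "y = 0" using y IJ by auto
  qed
  then show ?thesis using J subspace_0 by (auto simp: ideal_of_def)
qed

lemma indecomposable_V: "indecomposable_alg V br"
  unfolding indecomposable_alg_def
proof (intro notI, elim exE conjE)
  fix I J assume I: "ideal_of V br I" and J: "ideal_of V br J" and ne: "I \<noteq> {0}" "J \<noteq> {0}"
    and IJ: "I \<inter> J = {0}" and V: "V = {x + y |x y. x \<in> I \<and> y \<in> J}"
  have sI: "subspace I" and sJ: "subspace J" and IV: "I \<subseteq> V"
    using I J by (auto simp: ideal_of_def)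
  have "u \<in> V" by simp
  then obtain i j where i: "i \<in> I" and j: "j \<in> J" and u: "u = i + j" unfolding V by auto
  have unique: "x = x'" if "x \<in> I" "x' \<in> I" "y \<in> J" "y' \<in> J" "x + y = x' + y'" for x x' y y'
  proof -
    have "x - x' = y' - y" using that(5) by (simp add: algebra_simps)
    then have "x - x' \<in> I \<inter> J" using that sI sJ by (metis IntI subspace_diff)
    then show ?thesis using IJ by simp
  qed
  have "s \<cdot> i \<in> I" "s \<cdot> j \<in> J" "t \<cdot> i \<in> I" "t \<cdot> j \<in> J"
    using I J i j by (auto simp: ideal_of_def)
  moreover have "s \<cdot> i + s \<cdot> j = i + j" "t \<cdot> i + t \<cdot> j = 0 + 0"
    using su tu by (simp_all add: u bilin_simps)
  \<comment> \<open>Ideals are stable under \<open>s\<close> and \<open>t\<close>, so uniqueness of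
    the decomposition gives the component \<open>i\<close> the weight of \<open>u\<close>.\<close>
  ultimately have "s \<cdot> i = i" "t \<cdot> i = 0"
    using unique i j sI sJ by (metis subspace_0)+
  then obtain a where a: "i = a *\<^sub>R u" using i IV weight_space_u by blast
  show False
  proof (cases "a = 0")
    case True
    then have "u \<in> J" using a u j by simp
    then show False using complement_trivial[OF J I] IJ ne by blast
  next
    case False
    then have "u = (1 / a) *\<^sub>R i" using a by simp
    then have "u \<in> I" using i sI by (metis subspace_scale)
    then show False using complement_trivial[OF I J IJ] ne by blast
  qed
qed

end

section \<open>Weights of an extension with nilradical of codimension two\<close>

locale L2_ext = L2_dual br u w z c m pu pw pz pc
  for br :: "'a::real_vector \<Rightarrow> 'a \<Rightarrow> 'a" (infixl "\<cdot>" 70) and u w z c m pu pw pz pc +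
  fixes L :: "'a set"
  assumes leib: "x \<cdot> y \<cdot> v = x \<cdot> (y \<cdot> v) - y \<cdot> (x \<cdot> v)"
    and subspace_L: "subspace L" and closed_L: "x \<in> L \<Longrightarrow> y \<in> L \<Longrightarrow> x \<cdot> y \<in> L"
    and N_subset_L: "N \<subseteq> L" and L_N: "x \<in> L \<Longrightarrow> y \<in> N \<Longrightarrow> x \<cdot> y \<in> N"
    and N_L: "y \<in> N \<Longrightarrow> x \<in> L \<Longrightarrow> y \<cdot> x \<in> N"
    and solvable_L: "solvable_alg L br"
    and max_N: "ideal_of L br M \<Longrightarrow> nilpotent_alg M br \<Longrightarrow> N \<subseteq> M \<Longrightarrow> M = N"
begin

definition \<alpha> :: "'a \<Rightarrow> real" where "\<alpha> x = pu (x \<cdot> u)"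
definition \<beta> :: "'a \<Rightarrow> real" where "\<beta> x = pw (x \<cdot> w)"

lemma ab_simps:
  "\<alpha> (x + y) = \<alpha> x + \<alpha> y" "\<alpha> (x - y) = \<alpha> x - \<alpha> y" "\<alpha> (r *\<^sub>R x) = r * \<alpha> x" "\<alpha> 0 = 0"
  "\<beta> (x + y) = \<beta> x + \<beta> y" "\<beta> (x - y) = \<beta> x - \<beta> y" "\<beta> (r *\<^sub>R x) = r * \<beta> x" "\<beta> 0 = 0"
  by (simp_all add: \<alpha>_def \<beta>_def bilin_simps p_simps)

lemma derivation: "x \<cdot> (y \<cdot> v) = x \<cdot> y \<cdot> v + y \<cdot> (x \<cdot> v)"
  by (simp add: leib)

text \<open>The right side of the Leibniz identity is antisymmetric in \<open>x\<close> and
  \<open>y\<close>.\<close>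

lemma symmetrized_annihilates: "(x \<cdot> y + y \<cdot> x) \<cdot> v = 0"
  by (simp add: bilin_simps leib)

lemma z_eq: "z = u \<cdot> w + w \<cdot> u"
  by (simp add: L2_simps)

lemma z_left: "z \<cdot> v = 0"
  unfolding z_eq by (rule symmetrized_annihilates)

text \<open>Applying the derivation \<open>x \<cdot> _\<close> to \<open>u \<cdot> u = 0\<close>
  leaves \<open>b *\<^sub>R z\<close>, as the \<open>F\<close> part cancels by skew symmetry;
  \<open>z\<close> is nonzero, so \<open>b = 0\<close>. The relation \<open>w \<cdot> w = 0\<close>
  serves \<open>L_w\<close> likewise.\<close>

lemma L_u: assumes x: "x \<in> L" obtains f where "f \<in> F" "x \<cdot> u = \<alpha> x *\<^sub>R u + f"
proof -
  from L_N[OF x] have "x \<cdot> u \<in> N" by simp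
  then obtain a b f where f: "f \<in> F" "x \<cdot> u = a *\<^sub>R u + b *\<^sub>R w + f" by (rule N_cases)
  have "0 = x \<cdot> (u \<cdot> u)" by (simp add: L2_simps)
  also have "\<dots> = b *\<^sub>R z"
    unfolding derivation[of x] f(2) using f(1) by (simp add: bilin_simps L2_simps u_F algebra_simps)
  finally have "b = 0" using arg_cong[of 0 "b *\<^sub>R z" pz] by (simp add: p_simps)
  moreover have "a = \<alpha> x" using f by (simp add: \<alpha>_def p_simps pu_F)
  ultimately show thesis using f that by simp
qed

lemma L_w: assumes x: "x \<in> L" obtains f where "f \<in> F" "x \<cdot> w = \<beta> x *\<^sub>R w + f"
proof -
  from L_N[OF x] have "x \<cdot> w \<in> N" by simp
  then obtain a b f where f: "f \<in> F" "x \<cdot> w = a *\<^sub>R u + b *\<^sub>R w + f" by (rule N_cases)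
  have "0 = x \<cdot> (w \<cdot> w)" by (simp add: L2_simps)
  also have "\<dots> = a *\<^sub>R z"
    unfolding derivation[of x] f(2) using f(1)
    by (simp add: bilin_simps L2_simps w_F F_w algebra_simps)
  finally have "a = 0" using arg_cong[of 0 "a *\<^sub>R z" pz] by (simp add: p_simps)
  moreover have "b = \<beta> x" using f by (simp add: \<beta>_def p_simps pw_F)
  ultimately show thesis using f that by simp
qed

text \<open>The corrections in \<open>F\<close> cancel in the symmetrized product, so
  \<open>z\<close> is an exact eigenvector.\<close>

lemma L_z: assumes x: "x \<in> L" shows "x \<cdot> z = (\<alpha> x + \<beta> x) *\<^sub>R z"
proof -
  obtain f where f: "f \<in> F" "x \<cdot> u = \<alpha> x *\<^sub>R u + f" by (rule L_u[OF x])
  obtain g where g: "g \<in> F" "x \<cdot> w = \<beta> x *\<^sub>R w + g" by (rule L_w[OF x])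
  show ?thesis
    unfolding z_eq bilin_simps derivation[of x] f(2) g(2) using f(1) g(1)
    by (simp add: bilin_simps L2_simps F_w w_F u_F algebra_simps)
qed

text \<open>Each step \<open>c (Suc k) = c k \<cdot> u\<close> adds one \<open>\<alpha> x\<close> to
  the diagonal entry, starting from \<open>\<alpha> x + \<beta> x\<close> at
  \<open>c 0 = w \<cdot> u\<close>.\<close>

lemma L_c: assumes x: "x \<in> L"
  shows "x \<cdot> c k - (real (Suc k) * \<alpha> x + \<beta> x) *\<^sub>R c k \<in> G (Suc k)"
proof (induction k)
  case 0
  obtain f where f: "f \<in> F" "x \<cdot> u = \<alpha> x *\<^sub>R u + f" by (rule L_u[OF x])
  obtain g where g: "g \<in> F" "x \<cdot> w = \<beta> x *\<^sub>R w + g" by (rule L_w[OF x])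
  have "x \<cdot> c 0 = x \<cdot> (w \<cdot> u)" by (simp add: L2_simps)
  also have "\<dots> = (\<alpha> x + \<beta> x) *\<^sub>R c 0 + g \<cdot> u"
    unfolding derivation[of x] f(2) g(2) using f(1) g(1)
    by (simp add: bilin_simps L2_simps w_F algebra_simps)
  finally show ?case using F_u[OF g(1)] by simp
next
  case (Suc k)
  define r where "r = x \<cdot> c k - (real (Suc k) * \<alpha> x + \<beta> x) *\<^sub>R c k"
  have r: "x \<cdot> c k = (real (Suc k) * \<alpha> x + \<beta> x) *\<^sub>R c k + r" by (simp add: r_def)
  obtain f where f: "f \<in> F" "x \<cdot> u = \<alpha> x *\<^sub>R u + f" by (rule L_u[OF x])
  have "x \<cdot> c (Suc k) = x \<cdot> (c k \<cdot> u)" by (simp add: L2_simps)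
  also have "\<dots> = (real (Suc (Suc k)) * \<alpha> x + \<beta> x) *\<^sub>R c (Suc k) + r \<cdot> u"
    unfolding derivation[of x] f(2) r using f(1)
    by (simp add: bilin_simps L2_simps F_F algebra_simps)
      (metis mult_2 scaleR_add_left)
  finally show ?case using G_u[of r "Suc k"] Suc by (simp add: r_def)
qed

lemma L_G: "x \<in> L \<Longrightarrow> y \<in> G k \<Longrightarrow> x \<cdot> y \<in> G k"
proof -
  assume x: "x \<in> L" and y: "y \<in> G k"
  have "x \<cdot> c j \<in> G k" if "k \<le> j" for j
  proof -
    have "x \<cdot> c j - (real (Suc j) * \<alpha> x + \<beta> x) *\<^sub>R c j \<in> G k"
      using L_c[OF x, of j] G_mono[of k "Suc j"] that by auto
    then show ?thesis
      using subspace_add[OF subspace_G, of _ k, OF _ subspace_scale[OF subspace_G c_in_G[OF that]]]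
      by (metis diff_add_cancel)
  qed
  then show ?thesis
    by (intro linear_span_in[OF linear_right y[unfolded G_def]]) auto
qed

lemma L_F: "x \<in> L \<Longrightarrow> y \<in> F \<Longrightarrow> x \<cdot> y \<in> F"
proof (erule F_cases)
  fix d g assume "x \<in> L" "g \<in> G 0" "y = d *\<^sub>R z + g"
  then show "x \<cdot> y \<in> F"
    using L_G[of x g 0] G_subset_F[of 0]
    by (auto simp: bilin_simps L_z intro!: subspace_add subspace_scale)
qed

text \<open>Left multiplication by \<open>x \<cdot> y\<close> is the commutator of two operators
  that are diagonal on \<open>N\<close> modulo \<open>F\<close>.\<close>

lemma ab_bracket:
  assumes x: "x \<in> L" and y: "y \<in> L" shows "\<alpha> (x \<cdot> y) = 0" "\<beta> (x \<cdot> y) = 0"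
proof -
  obtain f where f: "f \<in> F" "x \<cdot> u = \<alpha> x *\<^sub>R u + f" by (rule L_u[OF x])
  obtain g where g: "g \<in> F" "y \<cdot> u = \<alpha> y *\<^sub>R u + g" by (rule L_u[OF y])
  have "\<alpha> (x \<cdot> y) = pu (x \<cdot> (y \<cdot> u)) - pu (y \<cdot> (x \<cdot> u))" by (simp add: \<alpha>_def leib p_simps)
  also have "\<dots> = 0"
    unfolding f(2) g(2) using L_F[OF x g(1)] L_F[OF y f(1)]
    by (simp add: bilin_simps f(2) g(2) p_simps pu_F f(1) g(1))
  finally show "\<alpha> (x \<cdot> y) = 0" .
  obtain f where f: "f \<in> F" "x \<cdot> w = \<beta> x *\<^sub>R w + f" by (rule L_w[OF x])
  obtain g where g: "g \<in> F" "y \<cdot> w = \<beta> y *\<^sub>R w + g" by (rule L_w[OF y])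
  have "\<beta> (x \<cdot> y) = pw (x \<cdot> (y \<cdot> w)) - pw (y \<cdot> (x \<cdot> w))" by (simp add: \<beta>_def leib p_simps)
  also have "\<dots> = 0"
    unfolding f(2) g(2) using L_F[OF x g(1)] L_F[OF y f(1)]
    by (simp add: bilin_simps f(2) g(2) p_simps pw_F f(1) g(1))
  finally show "\<beta> (x \<cdot> y) = 0" .
qed

lemma ab_N: assumes "x \<in> N" shows "\<alpha> x = 0" "\<beta> x = 0"
  using N_N[OF assms, of u] N_N[OF assms, of w] by (simp_all add: \<alpha>_def \<beta>_def pu_F pw_F)

text \<open>The product with \<open>w\<close> detects the coordinate at \<open>u\<close> through
  \<open>z\<close>; the product with \<open>u\<close> detects the one at \<open>w\<close> through
  \<open>c 0\<close>.\<close>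

lemma left_annihilator_N:
  assumes y: "y \<in> N" "y \<cdot> u = 0" "y \<cdot> w = 0" shows "y \<in> F"
proof -
  from y(1) obtain a b f where f: "f \<in> F" and yf: "y = a *\<^sub>R u + b *\<^sub>R w + f" by (rule N_cases)
  have "a *\<^sub>R (z - c 0) = 0"
    using y(3) f by (simp add: yf bilin_simps L2_simps F_w)
  then have a: "a = 0" using arg_cong[of "a *\<^sub>R (z - c 0)" 0 pz] by (simp add: p_simps)
  have "b *\<^sub>R c 0 + f \<cdot> u = 0"
    using y(2) f by (simp add: yf bilin_simps L2_simps)
  then have "pc 0 (b *\<^sub>R c 0 + f \<cdot> u) = 0" by (simp add: p_simps)
  then have "b = 0" using F_u[OF f] m_pos by (simp add: p_simps pc_G)
  with a f yf show ?thesis by simp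
qed

text \<open>Symmetrized products annihilate from the left. The lemma determines right
  multiplications on \<open>N\<close>, modulo \<open>F\<close>, from the left ones.\<close>

lemma symmetrized_in_F:
  assumes "x \<in> L" "y \<in> N" shows "x \<cdot> y + y \<cdot> x \<in> F"
  by (rule left_annihilator_N)
    (simp_all add: assms subspace_add L_N N_L symmetrized_annihilates)

section \<open>Right multiplication by elements with both weights zero\<close>

context
  fixes x assumes x: "x \<in> L" "\<alpha> x = 0" "\<beta> x = 0"
begin

lemma u_K: "u \<cdot> x \<in> F"
proof -
  obtain f where f: "f \<in> F" "x \<cdot> u = f" using L_u[OF x(1)] x(2) by auto
  then show ?thesis
    using subspace_diff[OF subspace_F symmetrized_in_F[OF x(1), of u] f(1)] by simp
qed

lemma w_K: "w \<cdot> x \<in> F"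
proof -
  obtain f where f: "f \<in> F" "x \<cdot> w = f" using L_w[OF x(1)] x(3) by auto
  then show ?thesis
    using subspace_diff[OF subspace_F symmetrized_in_F[OF x(1), of w] f(1)] by simp
qed

text \<open>Writing \<open>c 0\<close> and \<open>c (Suc k)\<close> as products with
  \<open>u\<close>, the Leibniz identity leaves a single term, a right multiplication by
  \<open>u\<close>, which moves one step down the filtration.\<close>

lemma c_K: "c k \<cdot> x \<in> G (Suc k)"
proof (induction k)
  case 0
  have "c 0 \<cdot> x = w \<cdot> (u \<cdot> x) - u \<cdot> (w \<cdot> x)" unfolding leib[symmetric] by (simp add: L2_simps)
  also have "\<dots> = w \<cdot> x \<cdot> u" using u_K w_K by (simp add: w_F u_F)
  finally show ?case using F_u[OF w_K] by simp
next
  case (Suc k)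
  have "c (Suc k) \<cdot> x = c k \<cdot> (u \<cdot> x) - u \<cdot> (c k \<cdot> x)" unfolding leib[symmetric] by (simp add: L2_simps)
  also have "\<dots> = c k \<cdot> x \<cdot> u" using u_K Suc G_subset_F[of "Suc k"] by (auto simp: F_F u_F)
  finally show ?case using G_u[OF Suc] by simp
qed

lemma G_K: "y \<in> G k \<Longrightarrow> y \<cdot> x \<in> G (Suc k)"
proof -
  assume "y \<in> G k"
  moreover have "c j \<cdot> x \<in> G (Suc k)" if "k \<le> j" for j
    using c_K[of j] G_mono[of "Suc k" "Suc j"] that by auto
  ultimately show ?thesis
    unfolding G_def[of k] by - (rule linear_span_in[OF linear_left _ subspace_G], auto)
qed

lemma F_K: "y \<in> F \<Longrightarrow> y \<cdot> x \<in> G 1"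
  by (erule F_cases) (use G_K in \<open>simp add: bilin_simps z_left\<close>)

lemma N_K: "y \<in> N \<Longrightarrow> y \<cdot> x \<in> F"
proof (erule N_cases)
  fix a b f assume "f \<in> F" "y = a *\<^sub>R u + b *\<^sub>R w + f"
  then show ?thesis
    using u_K w_K F_K[of f] G_subset_F[of 1]
    by (auto simp: bilin_simps intro!: subspace_add subspace_scale)
qed

end

text \<open>Right multiplication by \<open>I\<close> carries \<open>N\<close> into \<open>F\<close>,
  \<open>F\<close> into \<open>G 1\<close>, and \<open>G k\<close> into \<open>G (Suc k)\<close>.
  Only the products of \<open>I\<close> have to lie in \<open>N\<close>, so \<open>I\<close> may
  reach outside \<open>N\<close>.\<close>

lemma nilpotent_K:
  assumes "\<And>x. x \<in> I \<Longrightarrow> x \<in> L \<and> \<alpha> x = 0 \<and> \<beta> x = 0" and "\<And>x y. x \<in> I \<Longrightarrow> y \<in> I \<Longrightarrow> x \<cdot> y \<in> N"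
  shows "nilpotent_alg I br"
proof -
  have 1: "lower_central I br 1 \<subseteq> N"
    unfolding One_nat_def lower_central.simps bracket_span_def
    by (rule span_minimal) (use assms in auto)
  have 2: "lower_central I br (Suc 1) \<subseteq> F"
    unfolding lower_central.simps(2)[of _ _ 1] bracket_span_def
    by (rule span_minimal) (use 1 assms(1) N_K in auto)
  have "lower_central I br (k + 3) \<subseteq> G (Suc k)" for k
  proof (induction k)
    case 0
    have "lower_central I br (Suc (Suc 1)) \<subseteq> G 1"
      unfolding lower_central.simps(2)[of _ _ "Suc 1"] bracket_span_def
      by (rule span_minimal) (use 2 assms(1) F_K in auto)
    then show ?case by (simp add: numeral_3_eq_3)
  next
    case (Suc k)
    show ?case
      unfolding add_Suc lower_central.simps(2) bracket_span_def
      by (rule span_minimal) (use Suc assms(1) G_K in auto)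
  qed
  from this[of m] have "lower_central I br (m + 3) \<subseteq> {0}" by (simp add: G_trivial)
  moreover have "0 \<in> lower_central I br (m + 3)"
    by (simp add: numeral_3_eq_3 subspace_0)
  ultimately show ?thesis unfolding nilpotent_alg_def by blast
qed

text \<open>Left multiplications are derivations, and \<open>a \<cdot> b \<cdot> x\<close> equals
  \<open>a \<cdot> (b \<cdot> x) - b \<cdot> (a \<cdot> x)\<close>.\<close>

lemma ideal_derived: "ideal_of L br (derived_series L br k)"
proof (induction k)
  case 0
  then show ?case using subspace_L closed_L by (simp add: ideal_of_def)
next
  case (Suc k)
  let ?D = "derived_series L br k"
  have D: "?D \<subseteq> L" "\<And>x y. x \<in> L \<Longrightarrow> y \<in> ?D \<Longrightarrow> x \<cdot> y \<in> ?D" "\<And>x y. x \<in> L \<Longrightarrow> y \<in> ?D \<Longrightarrow> y \<cdot> x \<in> ?D"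
    using Suc by (auto simp: ideal_of_def)
  have "x \<cdot> y \<in> bracket_span br ?D ?D \<and> y \<cdot> x \<in> bracket_span br ?D ?D"
    if x: "x \<in> L" and y: "y \<in> bracket_span br ?D ?D" for x y
  proof
    have "x \<cdot> (a \<cdot> b) \<in> bracket_span br ?D ?D" "a \<cdot> b \<cdot> x \<in> bracket_span br ?D ?D"
      if "a \<in> ?D" "b \<in> ?D" for a b
      unfolding derivation[of x] leib[of a b x] using D x that
      by (auto intro!: subspace_add subspace_diff in_bracket_span)
    then show "x \<cdot> y \<in> bracket_span br ?D ?D" "y \<cdot> x \<in> bracket_span br ?D ?D"
      by (auto intro!: linear_span_in[OF linear_right y[unfolded bracket_span_def]]
          linear_span_in[OF linear_left y[unfolded bracket_span_def]])
  qed
  moreover have "bracket_span br ?D ?D \<subseteq> L"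
    unfolding bracket_span_def by (rule span_minimal) (use D(1) subspace_L closed_L in blast)+
  ultimately show ?case by (simp add: ideal_of_def)
qed

text \<open>Only here are solvability of \<open>L\<close> and maximality of \<open>N\<close> used.  The element \<open>x\<close> is not added
  to \<open>N\<close> directly, since the sum need not be an ideal; the last term of the derived series in which
  a counterexample occurs gives an ideal.\<close>

lemma K_subset_N:
  assumes "x \<in> L" "\<alpha> x = 0" "\<beta> x = 0" shows "x \<in> N"
proof -
  define H where "H k = {x \<in> derived_series L br k. \<alpha> x = 0 \<and> \<beta> x = 0}" for k
  have step: "H k \<subseteq> N" if Hk: "H (Suc k) \<subseteq> N" for k
  proof -
    have D: "ideal_of L br (derived_series L br k)" by (rule ideal_derived)
    have sH: "subspace (H k)"
      using D by (auto simp: H_def ideal_of_def subspace_def ab_simps)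
    define I where "I = {x + y |x y. x \<in> H k \<and> y \<in> N}"
    have HL: "H k \<subseteq> L" using D by (auto simp: H_def ideal_of_def)
    have "subspace I" unfolding I_def by (rule subspace_sums) (use sH in auto)
    moreover have IL: "I \<subseteq> L" using HL N_subset_L subspace_L by (auto simp: I_def intro: subspace_add)
    moreover have "v \<cdot> x \<in> I \<and> x \<cdot> v \<in> I" if "v \<in> L" "x \<in> I" for v x
    proof -
      from that(2) obtain p q where x: "x = p + q" "p \<in> H k" "q \<in> N" by (auto simp: I_def)
      have "v \<cdot> p \<in> H k" "p \<cdot> v \<in> H k"
        using D that(1) x(2) HL by (auto simp: H_def ideal_of_def ab_bracket subset_iff)
      then show ?thesis using L_N[OF that(1) x(3)] N_L[OF x(3) that(1)]
        by (auto simp: I_def x bilin_simps)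
    qed
    ultimately have "ideal_of L br I" by (simp add: ideal_of_def)
    moreover have "nilpotent_alg I br"
    proof (rule nilpotent_K)
      show "x \<in> L \<and> \<alpha> x = 0 \<and> \<beta> x = 0" if "x \<in> I" for x
        using that IL by (auto simp: I_def H_def ab_simps ab_N)
      show "x \<cdot> y \<in> N" if "x \<in> I" "y \<in> I" for x y
      proof -
        from that obtain p q p' q' where x: "x = p + q" "p \<in> H k" "q \<in> N"
          and y: "y = p' + q'" "p' \<in> H k" "q' \<in> N" by (auto simp: I_def)
        \<comment> \<open>The product has both weights zero and lies in the next derived term, so
          the descending induction puts it in \<open>N\<close>.\<close>
        have "p \<cdot> p' \<in> H (Suc k)"
          using x(2) y(2) HL by (auto simp: H_def ab_bracket subset_iff in_bracket_span)
        moreover have "p \<cdot> q' \<in> N" "q \<cdot> y \<in> N"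
          using x y that(2) HL IL by (auto intro!: L_N[of p] N_L[of q])
        ultimately have "p \<cdot> p' + p \<cdot> q' + q \<cdot> y \<in> N"
          using Hk by (intro subspace_add[OF subspace_N]) auto
        then show ?thesis by (simp add: x y bilin_simps algebra_simps)
      qed
    qed
    moreover have "N \<subseteq> I"
    proof
      fix y assume "y \<in> N"
      then have "0 + y \<in> I" unfolding I_def using subspace_0[OF sH] by blast
      then show "y \<in> I" by simp
    qed
    ultimately have I: "I = N" by (rule max_N)
    show "H k \<subseteq> N"
    proof
      fix y assume "y \<in> H k"
      then have "y + 0 \<in> I" unfolding I_def using zero_in(1) by blast
      then show "y \<in> N" using I by simp
    qed
  qed
  obtain k where "derived_series L br k = {0}" using solvable_L by (auto simp: solvable_alg_def)
  then have "H k \<subseteq> N" by (auto simp: H_def)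
  moreover have "H k \<subseteq> N \<Longrightarrow> H 0 \<subseteq> N" by (induction k) (use step in auto)
  ultimately show ?thesis using assms by (auto simp: H_def)
qed

end

section \<open>Eigenvectors of an element with weights 1 and 3\<close>

locale L2_ext_weight = L2_ext br u w z c m pu pw pz pc L
  for br :: "'a::real_vector \<Rightarrow> 'a \<Rightarrow> 'a" (infixl "\<cdot>" 70) and u w z c m pu pw pz pc L +
  fixes h
  assumes h: "h \<in> L" "\<alpha> h = 1" "\<beta> h = 3"
begin

text \<open>The diagonal entry is \<open>real (Suc k) + 3\<close>. With 1 on \<open>u\<close>, 3 on
  \<open>w\<close> and 4 on \<open>z\<close>, no weight of \<open>h\<close> on \<open>N\<close> is
  zero, and those on \<open>F\<close> are at least 4.\<close>

lemma h_c: obtains r where "r \<in> G (Suc k)" "h \<cdot> c k = (real k + 4) *\<^sub>R c k + r"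
  using L_c[OF h(1), of k] by (intro that[of "h \<cdot> c k - (real k + 4) *\<^sub>R c k"]) (auto simp: h algebra_simps)

lemma h_u: obtains f where "f \<in> F" "h \<cdot> u = u + f"
  by (rule L_u[OF h(1)]) (simp add: h)

lemma h_w: obtains f where "f \<in> F" "h \<cdot> w = 3 *\<^sub>R w + f"
  by (rule L_w[OF h(1)]) (simp add: h)

lemma h_z: "h \<cdot> z = 4 *\<^sub>R z"
  by (simp add: L_z h)

text \<open>On \<open>F\<close> the operator \<open>h \<cdot> _\<close> is triangular with diagonal entries at least 4.\<close>

lemma surj_G:
  assumes "\<mu> < 4" "g \<in> G k" shows "\<exists>y \<in> G k. h \<cdot> y - \<mu> *\<^sub>R y = g"
  using assms(2)
proof (induction "m - k" arbitrary: k g)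
  case 0
  then have "g = 0" using G_trivial[of k] by simp
  then show ?case by (intro bexI[of _ 0]) auto
next
  case (Suc d)
  obtain a g' where g: "g' \<in> G (Suc k)" "g = a *\<^sub>R c k + g'" using Suc.prems by (rule G_cases)
  obtain r where r: "r \<in> G (Suc k)" "h \<cdot> c k = (real k + 4) *\<^sub>R c k + r" by (rule h_c)
  define b where "b = a / (real k + 4 - \<mu>)"
  have b: "b * (real k + 4 - \<mu>) = a" using assms(1) by (simp add: b_def)
  have "g' - b *\<^sub>R r \<in> G (Suc k)" using g r by (intro subspace_diff subspace_scale) auto
  then obtain y where y: "y \<in> G (Suc k)" "h \<cdot> y - \<mu> *\<^sub>R y = g' - b *\<^sub>R r"
    using Suc.hyps(1)[of "Suc k"] Suc.hyps(2) by fastforce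
  have "h \<cdot> (b *\<^sub>R c k + y) - \<mu> *\<^sub>R (b *\<^sub>R c k + y)
      = (b * (real k + 4 - \<mu>)) *\<^sub>R c k + b *\<^sub>R r + (h \<cdot> y - \<mu> *\<^sub>R y)"
    by (simp add: bilin_simps r algebra_simps)
  also have "\<dots> = g" by (simp add: b y g)
  finally show ?case
    using y(1) G_mono[of k "Suc k"] c_in_G[of k k]
    by (intro bexI[of _ "b *\<^sub>R c k + y"]) (auto intro!: subspace_add subspace_scale)
qed

lemma surj_F:
  assumes "\<mu> < 4" "f \<in> F" obtains y where "y \<in> F" "h \<cdot> y - \<mu> *\<^sub>R y = f"
proof -
  obtain d g where g: "g \<in> G 0" "f = d *\<^sub>R z + g" using assms(2) by (rule F_cases)
  obtain y where y: "y \<in> G 0" "h \<cdot> y - \<mu> *\<^sub>R y = g" using surj_G[OF assms(1) g(1)] by blast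
  define b where "b = d / (4 - \<mu>)"
  have b: "b * (4 - \<mu>) = d" using assms(1) by (simp add: b_def)
  have "h \<cdot> (b *\<^sub>R z + y) - \<mu> *\<^sub>R (b *\<^sub>R z + y) = (b * (4 - \<mu>)) *\<^sub>R z + (h \<cdot> y - \<mu> *\<^sub>R y)"
    by (simp add: bilin_simps h_z algebra_simps)
  also have "\<dots> = f" by (simp only: b y g)
  finally show thesis
    using y(1) G_subset_F[of 0] by (intro that[of "b *\<^sub>R z + y"]) (auto intro!: subspace_add subspace_scale)
qed

lemma surj_N:
  assumes "x \<in> N" obtains y where "y \<in> N" "h \<cdot> y = x"
proof -
  obtain a b f where f: "f \<in> F" "x = a *\<^sub>R u + b *\<^sub>R w + f" using assms by (rule N_cases)
  obtain p where p: "p \<in> F" "h \<cdot> u = u + p" by (rule h_u)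
  obtain q where q: "q \<in> F" "h \<cdot> w = 3 *\<^sub>R w + q" by (rule h_w)
  have "f - a *\<^sub>R p - (b / 3) *\<^sub>R q \<in> F" using f p q by (intro subspace_diff subspace_scale) auto
  then obtain y where y: "y \<in> F" "h \<cdot> y - 0 *\<^sub>R y = f - a *\<^sub>R p - (b / 3) *\<^sub>R q"
    by (rule surj_F[of 0, rotated]) auto
  show thesis
  proof (rule that)
    show "a *\<^sub>R u + (b / 3) *\<^sub>R w + y \<in> N" using y(1) by (rule NI)
    show "h \<cdot> (a *\<^sub>R u + (b / 3) *\<^sub>R w + y) = x"
      using y f p q by (simp add: bilin_simps algebra_simps)
  qed
qed

text \<open>Brackets are identified below by this test: on \<open>N\<close> the eigenvalues under 4
  are 1 and 3, both simple, so such an eigenvector vanishes once its coordinate at \<open>u\<close>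
  or \<open>w\<close> does.\<close>

lemma inj_N:
  assumes y: "y \<in> N" "h \<cdot> y = \<mu> *\<^sub>R y" and "\<mu> < 4"
    and "\<mu> = 1 \<Longrightarrow> pu y = 0" "\<mu> = 3 \<Longrightarrow> pw y = 0"
  shows "y = 0"
proof -
  obtain a b f where f: "f \<in> F" "y = a *\<^sub>R u + b *\<^sub>R w + f" using y(1) by (rule N_cases)
  obtain p where p: "p \<in> F" "h \<cdot> u = u + p" by (rule h_u)
  obtain q where q: "q \<in> F" "h \<cdot> w = 3 *\<^sub>R w + q" by (rule h_w)
  have hf: "h \<cdot> f \<in> F" using L_F[OF h(1) f(1)] .
  have e: "h \<cdot> y = a *\<^sub>R u + a *\<^sub>R p + (3 * b) *\<^sub>R w + b *\<^sub>R q + h \<cdot> f"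
    by (simp add: f bilin_simps p q algebra_simps)
  have "pu (h \<cdot> y) = a" "pw (h \<cdot> y) = 3 * b" "pu y = a" "pw y = b"
    unfolding e using f p q hf by (simp_all add: f(2) p_simps pu_F pw_F)
  then have "a = \<mu> * a" "3 * b = \<mu> * b" using y(2) by (simp_all add: p_simps)
  then have "a = 0" "b = 0" using assms(4,5) \<open>pu y = a\<close> \<open>pw y = b\<close> by auto
  then have yF: "y \<in> F" using f by simp
  then obtain d g where g: "g \<in> G 0" "y = d *\<^sub>R z + g" by (rule F_cases)
  have "h \<cdot> y = (4 * d) *\<^sub>R z + h \<cdot> g" by (simp add: g bilin_simps h_z)
  then have "pz (h \<cdot> y) = 4 * d" "pz y = d"
    using g L_G[OF h(1) g(1)] by (simp_all add: p_simps pz_G)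
  then have "4 * d = \<mu> * d" using y(2) by (simp add: p_simps)
  then have "y \<in> G 0" using g assms(3) by auto
  have "y \<in> G k" for k
  proof (induction k)
    case 0
    then show ?case by fact
  next
    case (Suc k)
    obtain a g where g: "g \<in> G (Suc k)" "y = a *\<^sub>R c k + g" using Suc by (rule G_cases)
    obtain r where r: "r \<in> G (Suc k)" "h \<cdot> c k = (real k + 4) *\<^sub>R c k + r" by (rule h_c)
    have hy: "h \<cdot> y = (a * (real k + 4)) *\<^sub>R c k + a *\<^sub>R r + h \<cdot> g"
      by (simp add: g bilin_simps r algebra_simps)
    show ?case
    proof (cases "k < m")
      case True
      then have "pc k (h \<cdot> y) = a * (real k + 4)" "pc k y = a"
        unfolding hy using g r L_G[OF h(1) g(1)] by (simp_all add: p_simps pc_G)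
      then have "(real k + 4 - \<mu>) * a = 0" using y(2) by (simp add: p_simps algebra_simps)
      moreover have "real k + 4 - \<mu> \<noteq> 0" using assms(3) by auto
      ultimately have "a = 0" by simp
      then show ?thesis using g by simp
    qed (use g in \<open>simp add: c_eq_0\<close>)
  qed
  from this[of m] show "y = 0" by (simp add: G_trivial)
qed

text \<open>As \<open>h \<cdot> _\<close> maps \<open>N\<close> onto itself,
  \<open>h \<cdot> x\<close> can be cancelled by changing \<open>x\<close> within its coset of
  \<open>N\<close>.\<close>

lemma weight_vector:
  assumes "x \<in> L" "h \<cdot> x \<in> N" obtains y where "y \<in> L" "h \<cdot> y = 0" "x - y \<in> N"
proof -
  obtain v where "v \<in> N" "h \<cdot> v = h \<cdot> x" using assms(2) by (rule surj_N)
  then show thesis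
    using assms N_subset_L subspace_L
    by (intro that[of "x - v"]) (auto simp: bilin_simps intro: subspace_diff)
qed

lemma h_bracket: "h \<cdot> x = a *\<^sub>R x \<Longrightarrow> h \<cdot> y = b *\<^sub>R y \<Longrightarrow> h \<cdot> (x \<cdot> y) = (a + b) *\<^sub>R (x \<cdot> y)"
  by (simp add: derivation[of h] bilin_simps algebra_simps)

theorem exists_l_tab:
  assumes s0: "s0 \<in> L" "\<alpha> s0 = 1" "\<beta> s0 = 0" and t0: "t0 \<in> L" "\<alpha> t0 = 0" "\<beta> t0 = 1"
  shows "\<exists>u' w' c' s t. l_tab br u' w' z c' m s t \<and> l_tab.V u' w' z c' s t = L"
proof -
  have L_ab_N: "x \<in> N" if "x \<in> L" "\<alpha> x = 0" "\<beta> x = 0" for x using K_subset_N that .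
  have hN: "h \<cdot> x \<in> N" if "x \<in> L" for x
    using that h(1) by (intro L_ab_N) (auto simp: ab_bracket closed_L)
  obtain s where s: "s \<in> L" "h \<cdot> s = 0" "s0 - s \<in> N" using weight_vector[OF s0(1) hN[OF s0(1)]] .
  obtain t where t: "t \<in> L" "h \<cdot> t = 0" "t0 - t \<in> N" using weight_vector[OF t0(1) hN[OF t0(1)]] .
  have ab_s: "\<alpha> s = 1" "\<beta> s = 0" using ab_N[OF s(3)] s0 by (simp_all add: ab_simps)
  have ab_t: "\<alpha> t = 0" "\<beta> t = 1" using ab_N[OF t(3)] t0 by (simp_all add: ab_simps)
  \<comment> \<open>The product has \<open>\<alpha>\<close> and \<open>\<beta>\<close> zero, so it
    lies in \<open>N\<close>, where \<open>h\<close> has no eigenvalue 0.\<close>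
  have T: "x \<cdot> y = 0" if "x \<in> {s, t}" "y \<in> {s, t}" for x y
  proof (rule inj_N[of _ 0])
    have "x \<in> L" "y \<in> L" "h \<cdot> x = 0 *\<^sub>R x" "h \<cdot> y = 0 *\<^sub>R y" using that s t by auto
    then show "x \<cdot> y \<in> N" "h \<cdot> (x \<cdot> y) = 0 *\<^sub>R (x \<cdot> y)"
      using h_bracket[of x 0 y 0] by (auto intro!: L_ab_N closed_L simp: ab_bracket)
  qed auto
  obtain p where p: "p \<in> F" "h \<cdot> u = u + p" by (rule h_u)
  \<comment> \<open>Solving this equation makes \<open>u - g\<close> an exact eigenvector of
    \<open>h\<close>; \<open>k\<close> does the same for \<open>w\<close> with eigenvalue 3.\<close>
  obtain g where g: "g \<in> F" "h \<cdot> g - 1 *\<^sub>R g = p" by (rule surj_F[of 1, OF _ p(1)]) auto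
  obtain q where q: "q \<in> F" "h \<cdot> w = 3 *\<^sub>R w + q" by (rule h_w)
  obtain k where k: "k \<in> F" "h \<cdot> k - 3 *\<^sub>R k = q" by (rule surj_F[of 3, OF _ q(1)]) auto
  define u' where "u' = u - g"
  define w' where "w' = w - k"
  have hu': "h \<cdot> u' = 1 *\<^sub>R u'" using g(2) by (simp add: u'_def bilin_simps p algebra_simps)
  have hw': "h \<cdot> w' = 3 *\<^sub>R w'" using k(2) by (simp add: w'_def bilin_simps q algebra_simps)
  have N': "u' \<in> N" "w' \<in> N" "u' \<in> L" "w' \<in> L"
    using g(1) k(1) F_subset_N N_subset_L by (auto simp: u'_def w'_def intro!: subspace_diff subsetD[OF N_subset_L])
  have pu': "pu u' = 1" "pw w' = 1" "pw u' = 0" "pu w' = 0"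
    using g k by (simp_all add: u'_def w'_def p_simps pu_F pw_F)
  have pu_L: "pu (x \<cdot> u') = \<alpha> x" "pw (x \<cdot> w') = \<beta> x" if "x \<in> L" for x
  proof -
    have "x \<cdot> g \<in> F" "x \<cdot> k \<in> F" using L_F that g k by auto
    then show "pu (x \<cdot> u') = \<alpha> x" "pw (x \<cdot> w') = \<beta> x"
      by (simp_all add: u'_def w'_def bilin_simps p_simps pu_F pw_F \<alpha>_def \<beta>_def)
  qed
  \<comment> \<open>Both sides have the same eigenvalue under \<open>h\<close> and the same
    coordinate at \<open>u\<close> or \<open>w\<close>.\<close>
  have left: "x \<cdot> u' = \<alpha> x *\<^sub>R u'" "x \<cdot> w' = \<beta> x *\<^sub>R w'" if x: "x \<in> {s, t}" for x
  proof -
    have xL: "x \<in> L" and hx: "h \<cdot> x = 0 *\<^sub>R x" using x s t by auto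
    have "x \<cdot> u' - \<alpha> x *\<^sub>R u' = 0"
      by (rule inj_N[of _ 1])
        (use h_bracket[OF hx hu'] L_N[OF xL N'(1)] N' hu' in
          \<open>auto simp: bilin_simps p_simps pu' pu_L[OF xL] algebra_simps intro!: subspace_diff subspace_scale\<close>)
    moreover have "x \<cdot> w' - \<beta> x *\<^sub>R w' = 0"
      by (rule inj_N[of _ 3])
        (use h_bracket[OF hx hw'] L_N[OF xL N'(2)] N' hw' in
          \<open>auto simp: bilin_simps p_simps pu' pu_L[OF xL] algebra_simps intro!: subspace_diff subspace_scale\<close>)
    ultimately show "x \<cdot> u' = \<alpha> x *\<^sub>R u'" "x \<cdot> w' = \<beta> x *\<^sub>R w'" by simp_all
  qed
  \<comment> \<open>The symmetrized product has eigenvalue 1 or 3 but lies in \<open>F\<close>,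
    whose weights are at least 4.\<close>
  have right: "u' \<cdot> x = - (x \<cdot> u')" "w' \<cdot> x = - (x \<cdot> w')" if x: "x \<in> {s, t}" for x
  proof -
    have xL: "x \<in> L" and hx: "h \<cdot> x = 0 *\<^sub>R x" using x s t by auto
    have F: "x \<cdot> y + y \<cdot> x \<in> F" if "y \<in> N" for y using symmetrized_in_F xL that .
    have "x \<cdot> u' + u' \<cdot> x = 0"
      by (rule inj_N[of _ 1])
        (use h_bracket[OF hx hu'] h_bracket[OF hu' hx] F[OF N'(1)] F_subset_N in
          \<open>auto simp: bilin_simps pu_F pw_F\<close>)
    moreover have "x \<cdot> w' + w' \<cdot> x = 0"
      by (rule inj_N[of _ 3])
        (use h_bracket[OF hx hw'] h_bracket[OF hw' hx] F[OF N'(2)] F_subset_N in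
          \<open>auto simp: bilin_simps pu_F pw_F algebra_simps\<close>)
    ultimately show "u' \<cdot> x = - (x \<cdot> u')" "w' \<cdot> x = - (x \<cdot> w')"
      by (simp_all add: eq_neg_iff_add_eq_0 add.commute)
  qed
  \<comment> \<open>Generating \<open>c'\<close> afresh makes right multiplication by
    \<open>u'\<close> correct by construction; \<open>c'_G\<close> shows that the change from
    \<open>c\<close> is unitriangular.\<close>
  define c' where "c' j = ((\<lambda>y. y \<cdot> u') ^^ j) (w' \<cdot> u')" for j
  have c'_0: "c' 0 = w' \<cdot> u'" and c'_Suc: "c' (Suc j) = c' j \<cdot> u'" for j by (simp_all add: c'_def)
  have c'_G: "c' j - c j \<in> G (Suc j)" for j
  proof (induction j)
    case 0
    have "c' 0 - c 0 = - (k \<cdot> u)"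
      using g(1) k(1) by (simp add: c'_0 u'_def w'_def bilin_simps L2_simps w_F F_F)
    then show ?case using F_u[OF k(1)] by (simp add: subspace_neg)
  next
    case (Suc j)
    have F: "c' j - c j \<in> F" using Suc G_subset_F by auto
    have "c' (Suc j) - c (Suc j) = (c' j - c j) \<cdot> u - (c' j - c j) \<cdot> g - c j \<cdot> g"
      by (simp add: c'_Suc u'_def bilin_simps L2_simps algebra_simps)
    also have "\<dots> = (c' j - c j) \<cdot> u" using F g(1) by (simp add: F_F)
    finally show ?case using G_u[OF Suc] by simp
  qed
  have c'_in: "c' j \<in> G j" for j
    using subspace_add[OF subspace_G, of "c' j - c j" j "c j"] c'_G[of j] G_mono[of j "Suc j"]
      c_in_G[of j j] by auto
  then have c'_F: "c' j \<in> F" for j using G_subset_F by auto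
  \<comment> \<open>The corrections from \<open>F\<close> cancel in the symmetrized product, so the
    same \<open>z\<close> serves both bases.\<close>
  have z': "z = u' \<cdot> w' + w' \<cdot> u'"
    using g(1) k(1) by (simp add: u'_def w'_def bilin_simps L2_simps w_F F_w F_F u_F algebra_simps)
  have Lc': "x \<cdot> c' j = (real (Suc j) * \<alpha> x + \<beta> x) *\<^sub>R c' j" if x: "x \<in> {s, t}" for x j
  proof (induction j)
    case 0
    then show ?case
      using left[OF x] by (simp add: c'_0 derivation[of x] bilin_simps algebra_simps)
  next
    case (Suc j)
    then show ?case
      using left[OF x]
      by (simp add: c'_Suc derivation[of x] bilin_simps algebra_simps) (metis mult_2 scaleR_add_left)
  qed
  have u'_c': "u' \<cdot> c' j = - c' (Suc j)" for j
    using N_F_skew[OF N'(1) c'_F] by (simp add: c'_Suc)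
  have Rc0: "c' 0 \<cdot> x = w' \<cdot> (u' \<cdot> x) - u' \<cdot> (w' \<cdot> x)" for x by (simp add: c'_0 leib)
  have RcS: "c' (Suc j) \<cdot> x = c' j \<cdot> (u' \<cdot> x) - u' \<cdot> (c' j \<cdot> x)" for j x by (simp add: c'_Suc leib)
  have uw': "u' \<cdot> w' = z - c' 0" using z' by (simp add: c'_0)
  have sides: "s \<cdot> u' = u'" "t \<cdot> u' = 0" "s \<cdot> w' = 0" "t \<cdot> w' = w'"
    "u' \<cdot> s = - u'" "u' \<cdot> t = 0" "w' \<cdot> s = 0" "w' \<cdot> t = - w'"
    using left[of s] left[of t] right[of s] right[of t] by (simp_all add: ab_s ab_t)
  have cs: "c' j \<cdot> s = - real (Suc j) *\<^sub>R c' j" for j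
  proof (induction j)
    case 0
    show ?case unfolding Rc0 by (simp add: sides bilin_simps c'_0)
  next
    case (Suc j)
    then show ?case by (simp add: RcS sides bilin_simps u'_c' flip: c'_Suc) (simp add: algebra_simps scaleR_2)
  qed
  have zu': "z \<cdot> v = 0" for v by (rule z_left)
  have u'z: "u' \<cdot> z = 0" "w' \<cdot> z = 0"
    using g(1) k(1) by (simp_all add: u'_def w'_def bilin_simps L2_simps F_F)
  \<comment> \<open>The term \<open>z\<close> enters at index 0 from \<open>u' \<cdot> w'\<close>
    and is lost at the next index because \<open>u' \<cdot> z = 0\<close>.\<close>
  have ct: "c' j \<cdot> t = (if j = 0 then z else 0) - c' j" for j
  proof (induction j)
    case 0
    then show ?case by (simp add: Rc0 sides bilin_simps uw')
  next
    case (Suc j)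
    then show ?case by (simp add: RcS sides bilin_simps u'_c' u'z)
  qed
  have sz: "s \<cdot> z = z" "t \<cdot> z = z" using s t ab_s ab_t by (simp_all add: L_z)
  interpret T: l_tab br u' w' z c' m s t
  proof unfold_locales
    show "u' \<cdot> u' = 0" "w' \<cdot> w' = 0"
      using g(1) k(1) by (simp_all add: u'_def w'_def bilin_simps L2_simps u_F w_F F_w F_F)
    show "c' j \<cdot> w' = 0" "w' \<cdot> c' j = 0" for j
      using c'_F[of j] k(1) by (simp_all add: w'_def bilin_simps F_w w_F F_F)
    show "z \<cdot> c' j = 0" "c' j \<cdot> z = 0" "c' i \<cdot> c' j = 0" for i j
      using c'_F by (simp_all add: F_F)
    show "c' j = 0" if "m \<le> j" for j using c'_in[of j] G_trivial[OF that] by simp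
    show "s \<cdot> c' j = real (Suc j) *\<^sub>R c' j" "t \<cdot> c' j = c' j" for j
      using Lc'[of s j] Lc'[of t j] by (simp_all add: ab_s ab_t)
  qed (simp_all add: T sides sz zu' u'z uw' ct cs u'_c' c'_Suc c'_0)
  have "T.V \<subseteq> L"
    unfolding T.V_def
    by (rule span_minimal)
      (use s t N' N_subset_L subspace_L c'_F F_subset_N in \<open>auto simp: image_subset_iff subset_iff\<close>)
  moreover have "L \<subseteq> T.V"
  proof -
    \<comment> \<open>As \<open>c' j - c j\<close> lies in \<open>G (Suc j)\<close>, the triangular
      change of basis is undone from the last index backwards.\<close>
    have G: "G j \<subseteq> T.V" for j
    proof (induction "m - j" arbitrary: j)
      case 0
      then show ?case using G_trivial[of j] subspace_0[OF T.subspace_V] by auto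
    next
      case (Suc d)
      then have IH: "G (Suc j) \<subseteq> T.V" by simp
      then have c: "c j \<in> T.V"
        using subspace_diff[OF T.subspace_V T.basis_in_V(6)[of j], of "c' j - c j"] c'_G[of j] by auto
      show ?case
      proof
        fix x assume "x \<in> G j"
        then obtain a y where "y \<in> G (Suc j)" "x = a *\<^sub>R c j + y" by (rule G_cases)
        then show "x \<in> T.V" using IH c by (auto intro!: subspace_add subspace_scale)
      qed
    qed
    have F: "F \<subseteq> T.V"
      unfolding F_def by (rule span_minimal) (use G[of 0] c_in_G[of 0] in auto)
    have "u' + g \<in> T.V" "w' + k \<in> T.V" using F g k by (auto intro!: subspace_add)
    then have uw: "u \<in> T.V" "w \<in> T.V" by (simp_all add: u'_def w'_def)
    have N: "N \<subseteq> T.V"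
      unfolding N_def by (rule span_minimal) (use G[of 0] c_in_G[of 0] uw in auto)
    show ?thesis
    proof
      fix x assume x: "x \<in> L"
      have "x - \<alpha> x *\<^sub>R s - \<beta> x *\<^sub>R t \<in> N"
        using x s t subspace_L
        by (intro L_ab_N) (auto simp: ab_simps ab_s ab_t intro!: subspace_diff subspace_scale)
      then have "(x - \<alpha> x *\<^sub>R s - \<beta> x *\<^sub>R t) + \<alpha> x *\<^sub>R s + \<beta> x *\<^sub>R t \<in> T.V"
        using N by (intro subspace_add[OF T.subspace_V] subspace_scale[OF T.subspace_V]) auto
      then show "x \<in> T.V" by simp
    qed
  qed
  ultimately show ?thesis using T.l_tab_axioms by blast
qed

end

context L2_ext begin

text \<open>The weights 1 and 3 of \<open>u\<close> and \<open>w\<close> make all weights of \<open>h = s0 + 3 t0\<close> on \<open>N\<close> nonzero and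
  separate those of \<open>u\<close> and \<open>w\<close> from the rest.\<close>

lemma exists_l_tab_of_codim_2:
  assumes x: "x \<in> L" and y: "y \<in> L" and indep: "\<And>a b. a *\<^sub>R x + b *\<^sub>R y \<in> N \<Longrightarrow> a = 0 \<and> b = 0"
  shows "\<exists>u' w' c' s t. l_tab br u' w' z c' m s t \<and> l_tab.V u' w' z c' s t = L"
proof -
  have K: "a = 0 \<and> b = 0"
    if "a * \<alpha> x + b * \<alpha> y = 0" "a * \<beta> x + b * \<beta> y = 0" for a b
    using that x y subspace_L
    by (intro indep K_subset_N) (auto simp: ab_simps intro!: subspace_add subspace_scale)
  \<comment> \<open>The determinant of the weights of \<open>x\<close> and \<open>y\<close>;
    \<open>s0\<close> and \<open>t0\<close> come from Cramer's rule. If it vanished,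
    \<open>K\<close> applied to its cofactors would make all four weights zero, against
    \<open>K\<close> itself.\<close>
  define \<Delta> where "\<Delta> = \<alpha> x * \<beta> y - \<alpha> y * \<beta> x"
  have "\<Delta> \<noteq> 0"
  proof
    assume "\<Delta> = 0"
    then have "\<beta> y = 0 \<and> - \<beta> x = 0" "\<alpha> y = 0 \<and> - \<alpha> x = 0"
      by (intro K; simp add: \<Delta>_def algebra_simps)+
    then show False using K[of 1 0] by simp
  qed
  define s0 where "s0 = (\<beta> y / \<Delta>) *\<^sub>R x + (- \<beta> x / \<Delta>) *\<^sub>R y"
  define t0 where "t0 = (- \<alpha> y / \<Delta>) *\<^sub>R x + (\<alpha> x / \<Delta>) *\<^sub>R y"
  have s0: "s0 \<in> L" "\<alpha> s0 = 1" "\<beta> s0 = 0" and t0: "t0 \<in> L" "\<alpha> t0 = 0" "\<beta> t0 = 1"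
    using x y subspace_L \<open>\<Delta> \<noteq> 0\<close>
    by (auto simp: s0_def t0_def ab_simps field_simps intro!: subspace_diff subspace_add subspace_scale)
      (auto simp: \<Delta>_def algebra_simps)
  interpret L2_ext_weight br u w z c m pu pw pz pc L "s0 + 3 *\<^sub>R t0"
    by unfold_locales
      (use s0 t0 subspace_L in \<open>auto simp: ab_simps intro!: subspace_add subspace_scale\<close>)
  show ?thesis using exists_l_tab[OF s0 t0] .
qed

end

section \<open>The coordinate algebras\<close>

lemma lookup_scaleR: "Poly_Mapping.lookup (a *\<^sub>R x) i = a * Poly_Mapping.lookup (x :: 'b \<Rightarrow>\<^sub>0 real) i"
proof -
  have "{i. a * Poly_Mapping.lookup x i \<noteq> 0} \<subseteq> Poly_Mapping.keys x"
    by (auto simp: in_keys_iff)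
  then have "finite {i. a * Poly_Mapping.lookup x i \<noteq> 0}"
    by (rule finite_subset) simp
  then show ?thesis by (simp add: scaleR_poly_mapping_def Abs_poly_mapping_inverse)
qed

lemma lookup_double: "Poly_Mapping.lookup (2 * x) i = 2 * Poly_Mapping.lookup (x :: nat \<Rightarrow>\<^sub>0 real) i"
  by (simp only: mult_2 lookup_add)

lemma linear_lookup: "linear (\<lambda>x :: 'b \<Rightarrow>\<^sub>0 real. Poly_Mapping.lookup x i)"
  by (rule linearI) (simp_all add: lookup_add lookup_scaleR)

text \<open>Index sets larger than the supports let several vectors share one index set, as
  additivity requires.\<close>

lemma table_bracket_superset:
  assumes "finite I" "finite J" "Poly_Mapping.keys x \<subseteq> I" "Poly_Mapping.keys y \<subseteq> J"
  shows "table_bracket T x y =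
    (\<Sum>i\<in>I. \<Sum>j\<in>J. (Poly_Mapping.lookup x i * Poly_Mapping.lookup y j) *\<^sub>R T i j)"
proof -
  have "table_bracket T x y =
      (\<Sum>i\<in>Poly_Mapping.keys x. \<Sum>j\<in>J. (Poly_Mapping.lookup x i * Poly_Mapping.lookup y j) *\<^sub>R T i j)"
    unfolding table_bracket_def
    by (intro sum.cong refl sum.mono_neutral_left) (use assms in \<open>auto simp: in_keys_iff\<close>)
  also have "\<dots> = (\<Sum>i\<in>I. \<Sum>j\<in>J. (Poly_Mapping.lookup x i * Poly_Mapping.lookup y j) *\<^sub>R T i j)"
    by (intro sum.mono_neutral_left) (use assms in \<open>auto simp: in_keys_iff\<close>)
  finally show ?thesis .
qed

lemma bilin_table_bracket: "bilin (table_bracket T)"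
proof
  fix x y v :: "nat \<Rightarrow>\<^sub>0 real" and r :: real
  let ?K = "Poly_Mapping.keys x \<union> Poly_Mapping.keys y \<union> Poly_Mapping.keys v"
  have K: "finite ?K" by simp
  have k: "Poly_Mapping.keys x \<subseteq> ?K" "Poly_Mapping.keys y \<subseteq> ?K" "Poly_Mapping.keys v \<subseteq> ?K"
    "Poly_Mapping.keys (x + y) \<subseteq> ?K" "Poly_Mapping.keys (y + v) \<subseteq> ?K"
    "Poly_Mapping.keys (r *\<^sub>R x) \<subseteq> ?K" "Poly_Mapping.keys (r *\<^sub>R y) \<subseteq> ?K"
    using Poly_Mapping.keys_add[of x y] Poly_Mapping.keys_add[of y v]
    by (auto simp: in_keys_iff lookup_scaleR)
  note s = table_bracket_superset[OF K K]
  show "table_bracket T (x + y) v = table_bracket T x v + table_bracket T y v"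
    by (simp only: s k lookup_add distrib_right scaleR_add_left sum.distrib)
  show "table_bracket T x (y + v) = table_bracket T x y + table_bracket T x v"
    by (simp only: s k lookup_add distrib_left scaleR_add_left sum.distrib)
  show "table_bracket T (r *\<^sub>R x) y = r *\<^sub>R table_bracket T x y"
    by (simp add: s k lookup_scaleR scaleR_sum_right mult.assoc)
  show "table_bracket T x (r *\<^sub>R y) = r *\<^sub>R table_bracket T x y"
    by (simp add: s k lookup_scaleR scaleR_sum_right mult.left_commute)
qed

lemma independent_e: "independent (e ` A)"
proof
  assume "dependent (e ` A)"
  then obtain i where i: "i \<in> A" "e i \<in> span (e ` A - {e i})" unfolding dependent_def by auto
  from i(2) have "Poly_Mapping.lookup (e i) i \<in> {0}"
    by (rule linear_span_in[OF linear_lookup]) (auto simp: lookup_single when_def)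
  then show False by simp
qed

lemma dim_span_e: "dim (span (e ` A)) = card A"
proof -
  have "inj_on e A" by (rule inj_onI) (metis lookup_single_eq lookup_single_not_eq zero_neq_one)
  then show ?thesis
    using real_vector.dim_span_eq_card_independent[OF independent_e[of A]] card_image by metis
qed

text \<open>A basis of \<open>\<L>\<^sup>2\<close> in which the torus acts diagonally from the left.  \<open>bs\<close> and \<open>bt\<close> span the
  complement of the nilradical in \<open>l_{n+2,1}\<close>.\<close>

definition bu :: "nat \<Rightarrow>\<^sub>0 real" where "bu = e 1 - e 3"
definition bw :: "nat \<Rightarrow>\<^sub>0 real" where "bw = e 3"
definition bz :: "nat \<Rightarrow>\<^sub>0 real" where "bz = e 2"
definition bc :: "nat \<Rightarrow> nat \<Rightarrow> (nat \<Rightarrow>\<^sub>0 real)" where "bc n k = (if k < n - 3 then e (k + 4) else 0)"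
definition bs :: "nat \<Rightarrow> (nat \<Rightarrow>\<^sub>0 real)" where "bs n = (- 1 / 2) *\<^sub>R (e (n + 1) + e (n + 2))"
definition bt :: "nat \<Rightarrow> (nat \<Rightarrow>\<^sub>0 real)" where "bt n = (1 / 2) *\<^sub>R (e (n + 1) - e (n + 2))"

lemmas b_defs = bu_def bw_def bz_def bc_def bs_def bt_def

context
  fixes n :: nat assumes n: "4 \<le> n"
begin

lemma L2_tab_L2_bracket: "L2_tab (L2_bracket n) bu bw bz (bc n) (n - 3)"
proof -
  interpret bilin "L2_bracket n" unfolding L2_bracket_def by (rule bilin_table_bracket)
  have [simp]: "L2_bracket n (e i) (e j) = L2_table n i j" for i j
    by (simp add: L2_bracket_def table_bracket_basis)
  show ?thesis
    using n by unfold_locales (auto simp: b_defs bilin_simps L2_table_def)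
qed

text \<open>Since \<open>e 1 = bu + bw\<close> and \<open>e 3 = bw\<close>, the coordinate at
  \<open>bw\<close> is the sum of the first and the third.\<close>

lemma L2_dual_L2_bracket:
  "L2_dual (L2_bracket n) bu bw bz (bc n) (n - 3)
     (\<lambda>x. Poly_Mapping.lookup x 1) (\<lambda>x. Poly_Mapping.lookup x 1 + Poly_Mapping.lookup x 3)
     (\<lambda>x. Poly_Mapping.lookup x 2)
     (\<lambda>k x. if k < n - 3 then Poly_Mapping.lookup x (k + 4) else 0)"
proof -
  interpret L2_tab "L2_bracket n" bu bw bz "bc n" "n - 3" by (rule L2_tab_L2_bracket)
  show ?thesis
    using n
    by unfold_locales
      (auto intro!: linearI simp: lookup_add lookup_minus lookup_scaleR lookup_single when_def
        b_defs algebra_simps)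
qed

lemma l_tab_l_bracket: "l_tab (l_bracket n) bu bw bz (bc n) (n - 3) (bs n) (bt n)"
proof -
  interpret bilin "l_bracket n" unfolding l_bracket_def by (rule bilin_table_bracket)
  have [simp]: "l_bracket n (e i) (e j) = l_table n i j" for i j
    by (simp add: l_bracket_def table_bracket_basis)
  show ?thesis
    using n
    by unfold_locales
      (auto simp: b_defs bilin_simps l_table_def L2_table_def lookup_add lookup_minus lookup_scaleR
        lookup_double lookup_single when_def field_simps intro!: poly_mapping_eqI)
qed

text \<open>From the left, \<open>e (n + 1)\<close> and \<open>e (n + 2)\<close> have weights
  \<open>(-1, 1)\<close> and \<open>(-1, -1)\<close> on \<open>bu\<close> and \<open>bw\<close>, so
  they are \<open>bt n - bs n\<close> and \<open>- bs n - bt n\<close>. The last two functionals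
  read off these coefficients.\<close>

lemma l_dual_l_bracket:
  "l_dual (l_bracket n) bu bw bz (bc n) (n - 3) (bs n) (bt n)
     (\<lambda>x. Poly_Mapping.lookup x 1) (\<lambda>x. Poly_Mapping.lookup x 1 + Poly_Mapping.lookup x 3)
     (\<lambda>x. Poly_Mapping.lookup x 2)
     (\<lambda>k x. if k < n - 3 then Poly_Mapping.lookup x (k + 4) else 0)
     (\<lambda>x. - Poly_Mapping.lookup x (n + 1) - Poly_Mapping.lookup x (n + 2))
     (\<lambda>x. Poly_Mapping.lookup x (n + 1) - Poly_Mapping.lookup x (n + 2))"
proof -
  interpret l_tab "l_bracket n" bu bw bz "bc n" "n - 3" "bs n" "bt n" by (rule l_tab_l_bracket)
  show ?thesis
    using n
    by unfold_locales
      (auto intro!: linearI simp: lookup_add lookup_minus lookup_scaleR lookup_single when_def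
        b_defs algebra_simps)
qed

end

section \<open>Spans of the two bases in coordinates\<close>

lemma span_eqI: "A \<subseteq> span B \<Longrightarrow> B \<subseteq> span A \<Longrightarrow> span A = span B"
  by (intro antisym span_minimal subspace_span)

lemma span_e_mem: "i \<in> A \<Longrightarrow> e i \<in> span (e ` A)"
  by (auto intro: span_base)

lemma nat_le_n_cases:
  fixes i n :: nat
  assumes "i \<in> {1..n}" obtains "i = 1" | "i = 2" | "i = 3" | "4 \<le> i" "i \<le> n"
  using assms by fastforce

lemma dim_coord_space: "dim (coord_space k) = k"
  unfolding coord_space_def by (simp only: dim_span_e) simp

context
  fixes n :: nat assumes n: "4 \<le> n"
begin

lemma e_eqs: "e 1 = bu + bw" "e 2 = bz" "e 3 = bw" "4 \<le> i \<Longrightarrow> i \<le> n \<Longrightarrow> e i = bc n (i - 4)"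
  "e (n + 1) = bt n - bs n" "e (n + 2) = - bs n - bt n"
  by (auto simp: b_defs algebra_simps lookup_add lookup_minus lookup_scaleR lookup_double
      lookup_single when_def intro!: poly_mapping_eqI)

lemma N_eq: "L2_tab.N bu bw bz (bc n) = coord_space n"
proof -
  interpret L2_tab "L2_bracket n" bu bw bz "bc n" "n - 3" by (rule L2_tab_L2_bracket[OF n])
  show ?thesis
    unfolding N_def coord_space_def
  proof (rule span_eqI)
    show "insert bu (insert bw (insert bz (range (bc n)))) \<subseteq> span (e ` {1..n})"
      using n by (auto simp: b_defs intro!: span_e_mem span_diff span_zero)
    show "e ` {1..n} \<subseteq> span (insert bu (insert bw (insert bz (range (bc n)))))"
      unfolding N_def[symmetric]
      by (auto elim!: nat_le_n_cases simp: e_eqs simp flip: One_nat_def intro!: subspace_add)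
  qed
qed

lemma F_eq: "L2_tab.F bz (bc n) = span (e ` insert 2 {4..n})"
proof -
  interpret L2_tab "L2_bracket n" bu bw bz "bc n" "n - 3" by (rule L2_tab_L2_bracket[OF n])
  show ?thesis
    unfolding F_def
  proof (rule span_eqI)
    show "insert bz (range (bc n)) \<subseteq> span (e ` insert 2 {4..n})"
      using n by (auto simp only: b_defs intro!: span_e_mem span_zero split: if_splits) auto
    show "e ` insert 2 {4..n} \<subseteq> span (insert bz (range (bc n)))"
      unfolding F_def[symmetric] by (auto simp: e_eqs)
  qed
qed

lemma V_eq: "l_tab.V bu bw bz (bc n) (bs n) (bt n) = coord_space (n + 2)"
proof -
  interpret l_tab "l_bracket n" bu bw bz "bc n" "n - 3" "bs n" "bt n" by (rule l_tab_l_bracket[OF n])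
  show ?thesis
    unfolding V_def coord_space_def
  proof (rule span_eqI)
    show "insert (bs n) (insert (bt n) (insert bu (insert bw (insert bz (range (bc n))))))
        \<subseteq> span (e ` {1..n + 2})"
      using n by (auto simp: b_defs intro!: span_e_mem span_diff span_add span_scale span_neg span_zero)
    have "{1..n + 2} = {1..n} \<union> {n + 1, n + 2}" by auto
    moreover have "e ` {1..n} \<subseteq> V"
      using N_eq N_subset_V span_superset[of "e ` {1..n}"] unfolding coord_space_def by auto
    moreover have "e ` {n + 1, n + 2} \<subseteq> V"
      unfolding image_insert e_eqs by (auto intro!: subspace_diff subspace_neg)
    ultimately show "e ` {1..n + 2}
        \<subseteq> span (insert (bs n) (insert (bt n) (insert bu (insert bw (insert bz (range (bc n)))))))"
      unfolding V_def[symmetric] by (simp only: image_Un Un_subset_iff)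
  qed
qed

lemma dim_F: "dim (span (e ` insert 2 {4..n})) = n - 2"
  using n unfolding dim_span_e by simp

end

section \<open>Isomorphism of algebras with the same table\<close>

lemma l_tab_hom:
  fixes f :: "'a::real_vector \<Rightarrow> 'b::real_vector"
  assumes "l_tab br u w z c m s t" and "l_tab br' u' w' z' c' m s' t'" and "linear f"
    and f: "f u = u'" "f w = w'" "f z = z'" "\<And>k. f (c k) = c' k" "f s = s'" "f t = t'"
    and x: "x \<in> l_tab.V u w z c s t" and y: "y \<in> l_tab.V u w z c s t"
  shows "f (br x y) = br' (f x) (f y)"
proof -
  interpret A: l_tab br u w z c m s t by fact
  interpret B: l_tab br' u' w' z' c' m s' t' by fact
  interpret f: linear f by fact
  let ?S = "insert s (insert t (insert u (insert w (insert z (range c)))))"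
  have lin: "linear (\<lambda>x. f (br x y) - br' (f x) (f y))" "linear (\<lambda>y. f (br x y) - br' (f x) (f y))"
    for x y
    by (auto intro!: linearI simp: A.bilin_simps B.bilin_simps f.add f.scale algebra_simps)
  have "f (br a b) - br' (f a) (f b) \<in> {0}" if "a \<in> ?S" "b \<in> ?S" for a b
    using that
    by (auto simp: A.l_simps B.l_simps f f.add f.diff f.neg f.scale f.zero)
  then have "f (br x b) - br' (f x) (f b) \<in> {0}" if "b \<in> ?S" for b
    using that by - (rule linear_span_in[OF lin(1) x[unfolded A.V_def]], auto)
  then have "f (br x y) - br' (f x) (f y) \<in> {0}"
    by - (rule linear_span_in[OF lin(2) y[unfolded A.V_def]], auto)
  then show ?thesis by simp
qed

text \<open>Injectivity comes from the dimension alone: a spanning set of at most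
  \<open>dim V\<close> elements is a basis.\<close>

lemma bij_betw_linear_of_dim:
  assumes f: "linear f" and B: "finite B" "independent B" and V: "V = span (f ` B)" "dim V = card B"
  shows "bij_betw f (span B) V"
proof -
  obtain A where A: "A \<subseteq> f ` B" "independent A" "f ` B \<subseteq> span A"
    by (rule real_vector.maximal_independent_subset)
  have "card A = dim V"
    using A real_vector.basis_card_eq_dim[of A "f ` B"] V by simp
  moreover have "card A \<le> card (f ` B)" "card (f ` B) \<le> card B"
    using A(1) B by (simp_all add: card_mono card_image_le)
  ultimately have card: "card (f ` B) = card B" "card A = card (f ` B)" using V by simp_all
  then have "A = f ` B" using A(1) B by (simp add: card_subset_eq)
  with A card B have "inj_on f (span B)"
    by (intro real_vector.linear_inj_on_span_independent_image[OF f]) (auto intro: eq_card_imp_inj_on)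
  then show ?thesis
    using V real_vector.linear_span_image[OF f, of B] by (simp add: bij_betw_def)
qed

text \<open>The inverse has to be linear on the whole ambient space, so it is taken as a linear left
  inverse of \<open>f\<close> on \<open>V\<close>.\<close>

lemma alg_isomorphic_sym:
  assumes "left_leibniz V br" "alg_isomorphic V br W cr"
  shows "alg_isomorphic W cr V br"
proof -
  obtain f where f: "linear f" "bij_betw f V W" "\<And>x y. x \<in> V \<Longrightarrow> y \<in> V \<Longrightarrow> f (br x y) = cr (f x) (f y)"
    using assms(2) by (auto simp: alg_isomorphic_def)
  have V: "subspace V" "\<And>x y. x \<in> V \<Longrightarrow> y \<in> V \<Longrightarrow> br x y \<in> V"
    using assms(1) by (auto simp: left_leibniz_def)
  from f(2) have inj: "inj_on f V" and W: "f ` V = W" by (auto simp: bij_betw_def)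
  obtain g where g: "linear g" "\<And>v. v \<in> V \<Longrightarrow> g (f v) = v"
    using real_vector.linear_exists_left_inverse_on[OF f(1) V(1) inj] by auto
  have "bij_betw g W V"
    by (rule bij_betw_byWitness[of _ f]) (use g W in auto)
  moreover have "g (cr x y) = br (g x) (g y)" if "x \<in> W" "y \<in> W" for x y
  proof -
    from that W obtain a b where "a \<in> V" "b \<in> V" "x = f a" "y = f b" by auto
    then show ?thesis using f(3) g(2) V(2) by (metis (no_types))
  qed
  ultimately show ?thesis unfolding alg_isomorphic_def using g(1) by blast
qed

text \<open>The map starts from the coordinate space, where images of basis vectors can be
  prescribed, and is inverted at the end. The dimension supplies the independence of the table
  vectors.\<close>

lemma alg_isomorphic_l:
  fixes br :: "'a::real_vector \<Rightarrow> 'a \<Rightarrow> 'a"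
  assumes n: "4 \<le> n" and T: "l_tab br u w z c (n - 3) s t"
    and dim: "dim (l_tab.V u w z c s t) = n + 2"
  shows "alg_isomorphic (l_tab.V u w z c s t) br (coord_space (n + 2)) (l_bracket n)"
proof -
  interpret T: l_tab br u w z c "n - 3" s t by fact
  interpret M: l_tab "l_bracket n" bu bw bz "bc n" "n - 3" "bs n" "bt n" by (rule l_tab_l_bracket[OF n])
  \<comment> \<open>These are the expressions of \<open>e_eqs\<close> with the vectors of the given
    table.\<close>
  define B where "B i = (if i = 1 then u + w else if i = 2 then z else if i = 3 then w
    else if i \<le> n then c (i - 4) else if i = n + 1 then t - s else - s - t)" for i
  define f where "f x = (\<Sum>i\<in>{1..n + 2}. Poly_Mapping.lookup x i *\<^sub>R B i)" for x :: "nat \<Rightarrow>\<^sub>0 real"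
  have lin: "linear f"
    by (rule linearI)
      (simp_all only: f_def lookup_add lookup_scaleR scaleR_add_left sum.distrib scaleR_sum_right
        scaleR_scaleR)
  interpret f: linear f by fact
  have fe: "f (e i) = B i" if "i \<in> {1..n + 2}" for i
  proof -
    have "f (e i) = (\<Sum>j\<in>{1..n + 2}. if j = i then B j else 0)"
      unfolding f_def by (rule sum.cong) (auto simp: lookup_single when_def)
    then show ?thesis using that by simp
  qed
  have fe': "f (e 1) = u + w" "f (e 2) = z" "f (e 3) = w" "f (e (n + 1)) = t - s"
    "f (e (n + 2)) = - s - t"
    using n by (simp_all add: fe B_def)
  have "t - s + (- s - t) = (- 2) *\<^sub>R s" "t - s - (- s - t) = 2 *\<^sub>R t"
    by (simp_all add: scaleR_2)
  then have "f (bs n) = (- 1 / 2) *\<^sub>R (- 2) *\<^sub>R s" "f (bt n) = (1 / 2) *\<^sub>R 2 *\<^sub>R t"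
    by (simp_all only: b_defs f.add f.diff f.scale fe')
  then have fb: "f bu = u" "f bw = w" "f bz = z" "f (bs n) = s" "f (bt n) = t"
    by (simp_all add: bu_def bw_def bz_def f.diff fe'[unfolded One_nat_def])
  have fc: "f (bc n k) = c k" for k
    using n by (auto simp: bc_def fe B_def f.zero T.c_eq_0)
  have img: "span (f ` e ` {1..n + 2}) = T.V"
  proof -
    have "span (f ` e ` {1..n + 2}) = f ` M.V"
      using V_eq[OF n] by (simp add: coord_space_def real_vector.linear_span_image[OF lin])
    also have "\<dots> = T.V"
      by (simp add: M.V_def T.V_def real_vector.linear_span_image[OF lin, symmetric] fb fc image_image)
    finally show ?thesis .
  qed
  have "inj_on e {1..n + 2}"
    by (rule inj_onI) (metis lookup_single_eq lookup_single_not_eq zero_neq_one)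
  then have "dim T.V = card (e ` {1..n + 2})" using dim by (simp add: card_image)
  then have "bij_betw f (coord_space (n + 2)) T.V"
    unfolding coord_space_def
    by (intro bij_betw_linear_of_dim lin independent_e) (simp_all only: img finite_imageI finite_atLeastAtMost)
  moreover have "f (l_bracket n x y) = br (f x) (f y)"
    if "x \<in> coord_space (n + 2)" "y \<in> coord_space (n + 2)" for x y
    using l_tab_hom[OF M.l_tab_axioms T lin fb(1-3) fc fb(4,5)] that V_eq[OF n] by simp
  ultimately have "alg_isomorphic (coord_space (n + 2)) (l_bracket n) T.V br"
    unfolding alg_isomorphic_def using lin by blast
  moreover have "left_leibniz (coord_space (n + 2)) (l_bracket n)"
    using M.left_leibniz_V V_eq[OF n] by simp
  ultimately show ?thesis by (rule alg_isomorphic_sym[rotated])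
qed

section \<open>Uniqueness\<close>

text \<open>Composing the bracket with a linear projection onto \<open>V\<close> makes bilinearity and the Leibniz
  identity hold on the whole ambient space, without membership conditions.\<close>

lemma exists_total_leibniz:
  assumes "left_leibniz V br"
  obtains br' where "bilin br'" and "\<And>x y v. br' (br' x y) v = br' x (br' y v) - br' y (br' x v)"
    and "\<And>x y. x \<in> V \<Longrightarrow> y \<in> V \<Longrightarrow> br' x y = br x y"
proof -
  have V: "subspace V" using assms by (simp add: left_leibniz_def)
  obtain p where p: "range p \<subseteq> V" "linear p" "\<And>v. v \<in> V \<Longrightarrow> p v = v"
    using real_vector.linear_exists_left_inverse_on[OF linear_ident V] by auto
  have pV: "p x \<in> V" for x using p(1) by auto
  show thesis
  proof (rule that[of "\<lambda>x y. br (p x) (p y)"])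
    show "bilin (\<lambda>x y. br (p x) (p y))"
      by unfold_locales
        (use assms pV in \<open>auto simp: left_leibniz_def linear_add[OF p(2)] linear_scale[OF p(2)]\<close>)
  qed (use assms pV p(3) in \<open>auto simp: left_leibniz_def\<close>)
qed

section \<open>Independence of the values of the bracket outside \<open>V\<close>\<close>

context
  fixes V :: "'a::real_vector set" and br br' :: "'a \<Rightarrow> 'a \<Rightarrow> 'a"
  assumes eq: "\<And>x y. x \<in> V \<Longrightarrow> y \<in> V \<Longrightarrow> br' x y = br x y"
    and V: "subspace V" "\<And>x y. x \<in> V \<Longrightarrow> y \<in> V \<Longrightarrow> br x y \<in> V"
begin

lemma bracket_span_cong: "A \<subseteq> V \<Longrightarrow> B \<subseteq> V \<Longrightarrow> bracket_span br' A B = bracket_span br A B"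
proof -
  assume "A \<subseteq> V" "B \<subseteq> V"
  then have "br' x y = br x y" if "x \<in> A" "y \<in> B" for x y using eq that by auto
  then show ?thesis
    unfolding bracket_span_def by (intro arg_cong[of _ _ span] Collect_cong) metis
qed

lemma bracket_span_subset: "A \<subseteq> V \<Longrightarrow> B \<subseteq> V \<Longrightarrow> bracket_span br A B \<subseteq> V"
  unfolding bracket_span_def by (rule span_minimal) (use V in auto)

lemma nilpotent_alg_cong: "M \<subseteq> V \<Longrightarrow> nilpotent_alg M br' \<longleftrightarrow> nilpotent_alg M br"
proof -
  assume M: "M \<subseteq> V"
  have "lower_central M br k \<subseteq> V \<and> lower_central M br' k = lower_central M br k" for k
    by (induction k) (use M bracket_span_cong bracket_span_subset in auto)
  then show ?thesis by (simp add: nilpotent_alg_def)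
qed

lemma solvable_alg_cong: "solvable_alg V br' \<longleftrightarrow> solvable_alg V br"
proof -
  have "derived_series V br k \<subseteq> V \<and> derived_series V br' k = derived_series V br k" for k
    by (induction k) (use bracket_span_cong bracket_span_subset in auto)
  then show ?thesis by (simp add: solvable_alg_def)
qed

lemma ideal_of_cong: "ideal_of V br' M \<longleftrightarrow> ideal_of V br M"
  unfolding ideal_of_def using eq by (auto simp: subset_iff)

end

text \<open>Extending a basis of \<open>N\<close> to one of \<open>V\<close> adds two vectors, which
  are independent modulo \<open>N\<close>.\<close>

lemma exists_basis_mod_codim_2:
  fixes V N :: "'a::real_vector set"
  assumes "subspace V" "N \<subseteq> V" "dim N \<noteq> 0" "dim V = dim N + 2"
  obtains x y where "x \<in> V" "y \<in> V" "\<And>a b. a *\<^sub>R x + b *\<^sub>R y \<in> N \<Longrightarrow> a = 0 \<and> b = 0"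
proof -
  obtain A where A: "A \<subseteq> N" "independent A" "N \<subseteq> span A" "card A = dim N"
    by (rule real_vector.basis_exists)
  obtain B where B: "A \<subseteq> B" "B \<subseteq> V" "independent B" "V \<subseteq> span B"
    using real_vector.maximal_independent_subset_extend[of A V] A assms(2) by blast
  \<comment> \<open>\<open>card\<close> is 0 on infinite sets, so a nonzero dimension forces
    finiteness.\<close>
  have fin: "finite A" using A(4) assms(3) by (metis card.infinite)
  have "card B = dim N + 2" using real_vector.basis_card_eq_dim B assms(4) by metis
  then have "card (B - A) = 2" using A(4) B(1) fin by (simp add: card_Diff_subset)
  then obtain x y where xy: "B - A = {x, y}" "x \<noteq> y" by (auto simp: card_2_iff)
  have zero: "a = 0" if mem: "a *\<^sub>R v + b *\<^sub>R v' \<in> N" and v: "{v, v'} = B - A" "v \<noteq> v'" for a b v v'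
  proof (rule ccontr)
    assume a: "a \<noteq> 0"
    have sub: "A \<subseteq> B - {v}" "v' \<in> B - {v}" using B(1) v by auto
    have "a *\<^sub>R v + b *\<^sub>R v' \<in> span (B - {v})"
      using mem A(3) span_mono[OF sub(1)] by auto
    then have "(a *\<^sub>R v + b *\<^sub>R v') - b *\<^sub>R v' \<in> span (B - {v})"
      by (rule span_diff[OF _ span_scale[OF span_base[OF sub(2)]]])
    then have "a *\<^sub>R v \<in> span (B - {v})" by simp
    then have "(1 / a) *\<^sub>R (a *\<^sub>R v) \<in> span (B - {v})" by (rule span_scale)
    moreover have "(1 / a) *\<^sub>R (a *\<^sub>R v) = v" using a by simp
    ultimately have "v \<in> span (B - {v})" by (simp only:)
    then show False using B(3) v unfolding dependent_def by auto
  qed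
  show thesis
  proof (rule that)
    show "x \<in> V" "y \<in> V" using xy B(2) by auto
    show "a = 0 \<and> b = 0" if "a *\<^sub>R x + b *\<^sub>R y \<in> N" for a b
      using zero[of a x b y] zero[of b y a x] that xy by (auto simp: add.commute)
  qed
qed

text \<open>The basis of the coordinate algebra is carried into \<open>V\<close> by an inverse
  \<open>g\<close> of the given isomorphism, which yields an instance of \<open>L2_ext\<close> with
  nilradical \<open>R\<close>.\<close>

theorem solvable_extension_of_L2_unique:
  fixes V :: "'a::real_vector set"
  assumes n: "4 \<le> n" and A: "solvable_indecomposable_with_nilradical_L2 n V br"
  shows "alg_isomorphic V br (coord_space (n + 2)) (l_bracket n)"
proof -
  have leibV: "left_leibniz V br" and dimV: "dim V = n + 2" and solv: "solvable_alg V br"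
    using A by (auto simp: solvable_indecomposable_with_nilradical_L2_def)
  obtain R where nil: "is_nilradical V br R" and iso: "alg_isomorphic R br (coord_space n) (L2_bracket n)"
    using A by (auto simp: solvable_indecomposable_with_nilradical_L2_def)
  have V: "subspace V" "\<And>x y. x \<in> V \<Longrightarrow> y \<in> V \<Longrightarrow> br x y \<in> V"
    using leibV by (auto simp: left_leibniz_def)
  obtain br' where br': "bilin br'" "\<And>x y v. br' (br' x y) v = br' x (br' y v) - br' y (br' x v)"
    "\<And>x y. x \<in> V \<Longrightarrow> y \<in> V \<Longrightarrow> br' x y = br x y"
    using exists_total_leibniz[OF leibV] by blast
  have idR: "ideal_of V br R" and maxR: "\<And>M. ideal_of V br M \<Longrightarrow> nilpotent_alg M br \<Longrightarrow> R \<subseteq> M \<Longrightarrow> M = R"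
    using nil by (auto simp: is_nilradical_def maximal_nilpotent_ideal_def)
  then have RV: "R \<subseteq> V" and sR: "subspace R"
    and R: "\<And>x y. x \<in> V \<Longrightarrow> y \<in> R \<Longrightarrow> br' x y \<in> R" "\<And>x y. x \<in> V \<Longrightarrow> y \<in> R \<Longrightarrow> br' y x \<in> R"
    using br'(3) by (auto simp: ideal_of_def subset_iff)
  obtain f where f: "linear f" "bij_betw f R (coord_space n)"
    "\<And>x y. x \<in> R \<Longrightarrow> y \<in> R \<Longrightarrow> f (br x y) = L2_bracket n (f x) (f y)"
    using iso by (auto simp: alg_isomorphic_def)
  obtain g where g: "linear g" "range g \<subseteq> R" "\<And>v. v \<in> R \<Longrightarrow> g (f v) = v"
    using real_vector.linear_exists_left_inverse_on[OF f(1) sR] f(2) by (auto simp: bij_betw_def)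
  have fg: "f (g x) = x" if "x \<in> coord_space n" for x
    using that f(2) g(3) by (force simp: bij_betw_def)
  have gR: "g ` coord_space n = R"
    using f(2) g(3) unfolding bij_betw_def by force
  interpret M: L2_dual "L2_bracket n" bu bw bz "bc n" "n - 3"
    "\<lambda>x. Poly_Mapping.lookup x 1" "\<lambda>x. Poly_Mapping.lookup x 1 + Poly_Mapping.lookup x 3"
    "\<lambda>x. Poly_Mapping.lookup x 2" "\<lambda>k x. if k < n - 3 then Poly_Mapping.lookup x (k + 4) else 0"
    by (rule L2_dual_L2_bracket[OF n])
  have hom: "br' (g x) (g y) = g (L2_bracket n x y)" if "x \<in> M.N" "y \<in> M.N" for x y
  proof -
    have x: "g x \<in> R" "g y \<in> R" using g(2) by auto
    then have "br' (g x) (g y) = g (f (br (g x) (g y)))"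
      using R(1) RV br'(3) g(3) by (metis subsetD)
    also have "\<dots> = g (L2_bracket n x y)"
      using x that f(3) fg N_eq[OF n] by simp
    finally show ?thesis .
  qed
  interpret g: linear g by fact
  interpret bilin br' by fact
  interpret N: L2_tab br' "g bu" "g bw" "g bz" "\<lambda>k. g (bc n k)" "n - 3"
    by unfold_locales
      (simp_all add: hom M.L2_simps M.c_eq_0 g.diff g.neg g.zero)
  have NR: "N.N = R"
    unfolding N.N_def gR[symmetric] N_eq[OF n, symmetric] M.N_def
    by (simp add: real_vector.linear_span_image[OF g(1), symmetric] image_image)
  have fgM: "f (g x) = x" if "x \<in> M.N" for x using fg that N_eq[OF n] by simp
  let ?p1 = "\<lambda>i x. Poly_Mapping.lookup (f x) i"
  have lin: "linear (?p1 i)" for i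
    using linear_compose[OF f(1) linear_lookup] by (simp add: o_def)
  \<comment> \<open>The functionals are the coordinates of the model composed with \<open>f\<close>,
    which is linear on the whole ambient space.\<close>
  interpret L2_ext br' "g bu" "g bw" "g bz" "\<lambda>k. g (bc n k)" "n - 3" "?p1 1" "\<lambda>x. ?p1 1 x + ?p1 3 x"
    "?p1 2" "\<lambda>k x. if k < n - 3 then ?p1 (k + 4) x else 0" V
  proof (intro L2_ext.intro L2_dual.intro L2_dual_axioms.intro L2_ext_axioms.intro N.L2_tab_axioms)
    show "linear (\<lambda>x. ?p1 1 x + ?p1 3 x)" by (intro linear_compose_add lin)
    show "linear (\<lambda>x. if k < n - 3 then ?p1 (k + 4) x else 0)" for k
      using lin[of "k + 4"] by (cases "k < n - 3") (auto intro!: linearI)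
    show "br' x y \<in> V" if "x \<in> V" "y \<in> V" for x y using that V br'(3) by simp
    show "solvable_alg V br'" using solvable_alg_cong[OF br'(3) V] solv by simp
    show "M = N.N" if "ideal_of V br' M" "nilpotent_alg M br'" "N.N \<subseteq> M" for M
    proof -
      have "ideal_of V br M" using that(1) ideal_of_cong[OF br'(3) V] by simp
      moreover from this have "nilpotent_alg M br"
        using that(2) nilpotent_alg_cong[OF br'(3) V] by (simp add: ideal_of_def)
      ultimately show ?thesis using that(3) maxR NR by simp
    qed
  qed (use lin br'(2) V(1) NR RV R n in \<open>simp_all add: fgM\<close>,
      auto simp: b_defs lookup_minus lookup_single when_def)
  \<comment> \<open>Injectivity of \<open>g\<close> gives \<open>R\<close> dimension
    \<open>n\<close>, hence codimension two in \<open>V\<close>.\<close>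
  have inj: "inj_on g (coord_space n)" using fg by (metis inj_onI)
  have "R = span (g ` e ` {1..n})"
    using gR by (simp add: coord_space_def real_vector.linear_span_image[OF g(1)])
  moreover have "independent (g ` e ` {1..n})"
    by (rule real_vector.linear_independent_injective_image[OF g(1) independent_e])
      (use inj in \<open>simp add: coord_space_def\<close>)
  ultimately have "dim R = card (g ` e ` {1..n})"
    by (metis real_vector.dim_span_eq_card_independent)
  also have "\<dots> = card (e ` {1..n})"
    using inj span_superset[of "e ` {1..n}"] by (intro card_image) (auto simp: coord_space_def inj_on_subset)
  also have "\<dots> = dim (coord_space n)"
    unfolding coord_space_def using real_vector.dim_span_eq_card_independent[OF independent_e] by metis
  finally have "dim R = n" by (simp add: dim_coord_space)
  then obtain x y where xy: "x \<in> V" "y \<in> V" "\<And>a b. a *\<^sub>R x + b *\<^sub>R y \<in> R \<Longrightarrow> a = 0 \<and> b = 0"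
    using exists_basis_mod_codim_2[OF V(1) RV] dimV n by auto
  then obtain u' w' c' s t where T: "l_tab br' u' w' (g bz) c' (n - 3) s t"
    and VT: "l_tab.V u' w' (g bz) c' s t = V"
    using exists_l_tab_of_codim_2 NR by blast
  have "alg_isomorphic V br' (coord_space (n + 2)) (l_bracket n)"
    using alg_isomorphic_l[OF n T] dimV VT by simp
  then show ?thesis using br'(3) by (simp add: alg_isomorphic_def)
qed

section \<open>Existence and uniqueness of the extension, and dimensions of its series\<close>

theorem theorem5p2p4:
  fixes n :: nat
  assumes "4 \<le> n"
  shows
    "solvable_indecomposable_with_nilradical_L2 n (coord_space (n + 2)) (l_bracket n) \<and>
     is_nilradical (coord_space (n + 2)) (l_bracket n) (coord_space n) \<and>
     (\<forall>(V :: 'a::real_vector set) br.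
        solvable_indecomposable_with_nilradical_L2 n V br \<longrightarrow>
        alg_isomorphic V br (coord_space (n + 2)) (l_bracket n)) \<and>
     dim (derived_series (coord_space (n + 2)) (l_bracket n) 0) = n + 2 \<and>
     dim (derived_series (coord_space (n + 2)) (l_bracket n) 1) = n \<and>
     dim (derived_series (coord_space (n + 2)) (l_bracket n) 2) = n - 2 \<and>
     (\<forall>k\<ge>3. dim (derived_series (coord_space (n + 2)) (l_bracket n) k) = 0) \<and>
     dim (lower_central (coord_space (n + 2)) (l_bracket n) 0) = n + 2 \<and>
     (\<forall>k\<ge>1. dim (lower_central (coord_space (n + 2)) (l_bracket n) k) = n)"
proof -
  let ?V = "coord_space (n + 2)" and ?l = "l_bracket n"
  interpret l: l_dual ?l bu bw bz "bc n" "n - 3" "bs n" "bt n"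
    "\<lambda>x. Poly_Mapping.lookup x 1" "\<lambda>x. Poly_Mapping.lookup x 1 + Poly_Mapping.lookup x 3"
    "\<lambda>x. Poly_Mapping.lookup x 2"
    "\<lambda>k x. if k < n - 3 then Poly_Mapping.lookup x (k + 4) else 0"
    "\<lambda>x. - Poly_Mapping.lookup x (n + 1) - Poly_Mapping.lookup x (n + 2)"
    "\<lambda>x. Poly_Mapping.lookup x (n + 1) - Poly_Mapping.lookup x (n + 2)"
    by (rule l_dual_l_bracket[OF assms])
  interpret N: L2_tab "L2_bracket n" bu bw bz "bc n" "n - 3" by (rule L2_tab_L2_bracket[OF assms])
  note VN = V_eq[OF assms] N_eq[OF assms]
  \<comment> \<open>Both brackets satisfy the same table on the basis of the nilradical, so the
    identity is the required isomorphism.\<close>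
  have "?l x y = L2_bracket n x y" if "x \<in> coord_space n" "y \<in> coord_space n" for x y
  proof -
    let ?S = "insert bu (insert bw (insert bz (range (bc n))))"
    have lin: "linear (\<lambda>x. ?l x y - L2_bracket n x y)" "linear (\<lambda>y. ?l x y - L2_bracket n x y)" for x y
      by (auto intro!: linearI simp: l.bilin_simps N.bilin_simps algebra_simps)
    have "?l a b - L2_bracket n a b \<in> {0}" if "a \<in> ?S" "b \<in> ?S" for a b
      using that by (auto simp: l.L2_simps N.L2_simps)
    then have "?l x b - L2_bracket n x b \<in> {0}" if "b \<in> ?S" for b
      using that \<open>x \<in> coord_space n\<close> unfolding VN[symmetric] N.N_def
      by - (rule linear_span_in[OF lin(1)], assumption, auto)
    then have "?l x y - L2_bracket n x y \<in> {0}"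
      using \<open>y \<in> coord_space n\<close> unfolding VN[symmetric] N.N_def
      by - (rule linear_span_in[OF lin(2)], assumption, auto)
    then show ?thesis by simp
  qed
  then have iso: "alg_isomorphic (coord_space n) ?l (coord_space n) (L2_bracket n)"
    unfolding alg_isomorphic_def by (intro exI[of _ id]) (auto simp: linear_id bij_betw_id)
  have nil: "is_nilradical ?V ?l (coord_space n)"
    using l.is_nilradical_N by (simp only: VN)
  have "solvable_indecomposable_with_nilradical_L2 n ?V ?l"
    unfolding solvable_indecomposable_with_nilradical_L2_def
    using l.left_leibniz_V l.solvable_V l.indecomposable_V nil iso
    by (auto simp: VN dim_coord_space)
  moreover have "dim (derived_series ?V ?l 1) = n" "dim (derived_series ?V ?l 2) = n - 2"
    using l.derived_series_V(1,2) dim_F[OF assms] by (simp_all only: VN F_eq[OF assms] dim_coord_space)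
  moreover have "dim (derived_series ?V ?l k) = 0" if "3 \<le> k" for k
  proof -
    have "derived_series ?V ?l k = {0}" using l.derived_series_V(3)[of "k - 3"] that by (simp add: VN)
    then show ?thesis using real_vector.dim_span_eq_card_independent[OF independent_empty]
      by (metis span_empty card.empty)
  qed
  moreover have "dim (lower_central ?V ?l k) = n" if "1 \<le> k" for k
    using l.lower_central_V[of "k - 1"] that by (simp add: VN dim_coord_space)
  moreover have "alg_isomorphic V br ?V ?l"
    if "solvable_indecomposable_with_nilradical_L2 n V br" for V :: "'a set" and br
    using solvable_extension_of_L2_unique[OF assms that] .
  ultimately show ?thesis
    using nil dim_coord_space[of "n + 2"] by simp
qed

end
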